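(* Let $q\geq 2$ and $m\geq 2$ be integers and let $\alpha=[0;\overline{1,m}]$. Let $\theta,\gamma\in\mathbb{R}$ with $\|m\gamma\|\neq 0$. Then there exists $\delta>0$ such that $$\sum_{0\leq n<N}e\big(\theta S_q(n)+\gamma S_\alpha(n)\big)=O(N^{1-\delta})$$ for all positive integers $N$, where the implied $O$-constant depends only on $q$ and $m$.
   Context: $e(x)=\exp(2\pi i x)$ and $\|x\|=\min_{j\in\mathbb{Z}}|x-j|$. $S_q(n)$ denotes the sum of the digits of the non-negative integer $n$ in base $q$. The number $\alpha=[0;\overline{1,m}]=\frac{-m+\sqrt{m^2+4m}}{2}$ has simple continued fraction $[0;a_1,a_2,\ldots]$ with $a_i=1$ for $i$ odd and $a_i=m$ for $i$ even ($i\ge 1$). The denominators $(q_i)_{i\geq 0}$ of its convergents satisfy $q_0=q_1=1$ and, for $i\ge 2$, $q_i=mq_{i-1}+q_{i-2}$ if $i$ is even, $q_i=q_{i-1}+q_{i-2}$ if $i$ is odd. By Ostrowski's theorem every integer $n\geq 0$ can be written uniquely as $n=\sum_{i\geq 0}b_i(n)q_i$ (finitely many nonzero terms) with integers $b_i(n)$ satisfying: $0\leq b_0(n)<a_1$; $0\leq b_i(n)\leq a_{i+1}$ for $i\geq 1$; and for $i\geq 1$, if $b_i(n)=a_{i+1}$ then $b_{i-1}(n)=0$. This is the Ostrowski $\alpha$-representation of $n$, and $S_\alpha(n)=\sum_{i\geq 0}b_i(n)$. *)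

theory Defs
  imports "HOL-Analysis.Analysis"
begin

definition expi :: "real \<Rightarrow> complex" where
  "expi x = exp (2 * of_real pi * \<i> * of_real x)"

definition dist_nint :: "real \<Rightarrow> real" where
  "dist_nint x = infdist x \<int>"  (* the infimum is attained, since \<int> is closed *)

definition digit_sum :: "nat \<Rightarrow> nat \<Rightarrow> nat" where
  "digit_sum q n = (\<Sum>i | n div q ^ i mod q \<noteq> 0. n div q ^ i mod q)"

text \<open>Simple continued fraction expansion of an irrational \<open>x\<close>: the complete quotients and the
  partial quotients \<open>a\<^sub>i\<close>.  (For negative \<open>x\<close> the value at \<open>i = 0\<close> is truncated; only \<open>i \<ge> 1\<close> is
  used below.)\<close>

primrec cf_rem :: "real \<Rightarrow> nat \<Rightarrow> real" where
  "cf_rem x 0 = x"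
| "cf_rem x (Suc i) = 1 / frac (cf_rem x i)"

definition cf_pq :: "real \<Rightarrow> nat \<Rightarrow> nat" where
  "cf_pq x i = nat \<lfloor>cf_rem x i\<rfloor>"

fun cf_denom :: "real \<Rightarrow> nat \<Rightarrow> nat" where
  "cf_denom x 0 = 1"
| "cf_denom x (Suc 0) = cf_pq x 1"
| "cf_denom x (Suc (Suc i)) = cf_pq x (Suc (Suc i)) * cf_denom x (Suc i) + cf_denom x i"

definition ostrowski_adm :: "real \<Rightarrow> (nat \<Rightarrow> nat) \<Rightarrow> bool" where
  "ostrowski_adm \<alpha> b \<longleftrightarrow>
     b 0 < cf_pq \<alpha> 1 \<and>
     (\<forall>i\<ge>1. b i \<le> cf_pq \<alpha> (i + 1)) \<and>
     (\<forall>i\<ge>1. b i = cf_pq \<alpha> (i + 1) \<longrightarrow> b (i - 1) = 0)"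

definition ostrowski_rep :: "real \<Rightarrow> nat \<Rightarrow> (nat \<Rightarrow> nat) \<Rightarrow> bool" where
  "ostrowski_rep \<alpha> n b \<longleftrightarrow>
     ostrowski_adm \<alpha> b \<and> finite {i. b i \<noteq> 0} \<and>
     n = (\<Sum>i | b i \<noteq> 0. b i * cf_denom \<alpha> i)"

definition ostrowski_digit :: "real \<Rightarrow> nat \<Rightarrow> nat \<Rightarrow> nat" where
  "ostrowski_digit \<alpha> n = (THE b. ostrowski_rep \<alpha> n b)"

definition ostrowski_sum :: "real \<Rightarrow> nat \<Rightarrow> nat" where
  "ostrowski_sum \<alpha> n = (\<Sum>i | ostrowski_digit \<alpha> n i \<noteq> 0. ostrowski_digit \<alpha> n i)"

definition cf_1m :: "nat \<Rightarrow> real" where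
  "cf_1m m = (- real m + sqrt (real m ^ 2 + 4 * real m)) / 2"

text \<open>The closed form has the intended expansion \<open>[0; 1, m, 1, m, \<dots>]\<close>.\<close>

lemma cf_1m_bounds:
  assumes "m \<ge> 1"
  shows "0 < cf_1m m" "cf_1m m < 1"
proof -
  have "real m < sqrt (real m ^ 2 + 4 * real m)"
    using assms by (intro real_less_rsqrt) auto
  then show "0 < cf_1m m" by (simp add: cf_1m_def)
  have "sqrt (real m ^ 2 + 4 * real m) < real m + 2"
    by (intro real_less_lsqrt) (auto simp: power2_eq_square algebra_simps)
  then show "cf_1m m < 1" by (simp add: cf_1m_def)
qed

lemma cf_1m_eq: "cf_1m m ^ 2 + real m * cf_1m m = real m"
proof -
  have "sqrt (real m ^ 2 + 4 * real m) ^ 2 = real m ^ 2 + 4 * real m" by simp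
  then show ?thesis
    by (simp add: cf_1m_def power2_eq_square field_simps)
qed

lemma cf_rem_cf_1m:
  assumes "m \<ge> 1"
  shows "cf_rem (cf_1m m) (2 * k + 1) = 1 + 1 / (real m + cf_1m m)"
    and "cf_rem (cf_1m m) (2 * k + 2) = real m + cf_1m m"
proof -
  note b = cf_1m_bounds[OF assms]
  have m1: "real m \<ge> 1" using assms by simp
  have inv: "1 / cf_1m m = 1 + 1 / (real m + cf_1m m)"
    using b m1 cf_1m_eq[of m] by (simp add: field_simps power2_eq_square)
  have frac1: "frac (1 + 1 / (real m + cf_1m m)) = 1 / (real m + cf_1m m)"
    using b m1 by (simp add: frac_unique_iff)
  have frac2: "frac (real m + cf_1m m) = cf_1m m"
    using b by (simp add: frac_unique_iff)
  have frac0: "frac (cf_1m m) = cf_1m m"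
    using b by (simp add: frac_eq)
  have odd: "cf_rem (cf_1m m) (2 * k + 1) = 1 + 1 / (real m + cf_1m m) \<Longrightarrow>
      cf_rem (cf_1m m) (2 * k + 2) = real m + cf_1m m" for k
    using frac1 by simp
  have "cf_rem (cf_1m m) (2 * k + 1) = 1 + 1 / (real m + cf_1m m)"
  proof (induction k)
    case 0
    then show ?case using frac0 inv by simp
  next
    case (Suc k)
    then show ?case using odd[OF Suc] frac2 inv by simp
  qed
  then show "cf_rem (cf_1m m) (2 * k + 1) = 1 + 1 / (real m + cf_1m m)"
    and "cf_rem (cf_1m m) (2 * k + 2) = real m + cf_1m m" using odd by blast+
qed

lemma cf_pq_cf_1m:
  assumes "m \<ge> 1"
  shows "cf_pq (cf_1m m) 0 = 0"
    and "i \<ge> 1 \<Longrightarrow> cf_pq (cf_1m m) i = (if odd i then 1 else m)"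
proof -
  note b = cf_1m_bounds[OF assms]
  have m1: "real m \<ge> 1" using assms by simp
  show "cf_pq (cf_1m m) 0 = 0" using b by (simp add: cf_pq_def floor_eq_iff)
  have f1: "\<lfloor>1 + 1 / (real m + cf_1m m)\<rfloor> = 1"
    using b m1 by (simp add: floor_eq_iff)
  have f2: "\<lfloor>real m + cf_1m m\<rfloor> = int m"
    using b by (simp add: floor_eq_iff)
  assume i: "i \<ge> 1"
  show "cf_pq (cf_1m m) i = (if odd i then 1 else m)"
  proof (cases "odd i")
    case True
    then obtain k where "i = 2 * k + 1" by (auto elim: oddE)
    then show ?thesis using cf_rem_cf_1m(1)[OF assms, of k] f1 True by (simp only: cf_pq_def) simp
  next
    case False
    then obtain j where "i = 2 * j" by (auto elim: evenE)
    with i obtain k where "i = 2 * k + 2" by (cases j) auto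
    then show ?thesis using cf_rem_cf_1m(2)[OF assms, of k] f2 False by (simp only: cf_pq_def) simp
  qed
qed

text \<open>Ostrowski's theorem: the description operator in \<open>ostrowski_digit\<close> is well defined.\<close>

context
  fixes \<alpha> :: real
  assumes pq_pos: "\<And>i. i \<ge> 1 \<Longrightarrow> cf_pq \<alpha> i \<ge> 1"
begin

lemma cf_denom_pos: "cf_denom \<alpha> i \<ge> 1"
proof (induction i rule: induct_nat_012)
  case (ge2 i)
  then show ?case by simp
qed (use pq_pos[of 1] in auto)

lemma cf_denom_mono: "cf_denom \<alpha> i \<le> cf_denom \<alpha> (Suc i)"
proof (cases i)
  case 0
  then show ?thesis using pq_pos[of 1] by simp
next
  case (Suc j)
  have "1 * cf_denom \<alpha> (Suc j) \<le> cf_pq \<alpha> (Suc (Suc j)) * cf_denom \<alpha> (Suc j)"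
    by (rule mult_right_mono) (use pq_pos[of "Suc (Suc j)"] in auto)
  then show ?thesis unfolding Suc cf_denom.simps by linarith
qed

lemma cf_denom_ge: "i \<le> cf_denom \<alpha> i"
proof (induction i)
  case (Suc i)
  show ?case
  proof (cases i)
    case 0
    then show ?thesis using pq_pos[of 1] by simp
  next
    case (Suc j)
    have "1 * cf_denom \<alpha> (Suc j) \<le> cf_pq \<alpha> (Suc (Suc j)) * cf_denom \<alpha> (Suc j)"
      by (rule mult_right_mono) (use pq_pos[of "Suc (Suc j)"] in auto)
    then show ?thesis using Suc.IH cf_denom_pos[of j] unfolding Suc cf_denom.simps by linarith
  qed
qed simp

lemma ostrowski_adm_sum_less: "ostrowski_adm \<alpha> b \<Longrightarrow> (\<Sum>i<k. b i * cf_denom \<alpha> i) < cf_denom \<alpha> k"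
proof (induction k rule: less_induct)
  case (less k)
  consider "k = 0" | "k = 1" | j where "k = Suc (Suc j)"
    by (cases k; cases "k - 1") auto
  then show ?case
  proof cases
    case 3
    have le: "b (Suc j) \<le> cf_pq \<alpha> (Suc (Suc j))"
      using less.prems by (auto simp: ostrowski_adm_def)
    show ?thesis
    proof (cases "b (Suc j) = cf_pq \<alpha> (Suc (Suc j))")
      case True
      have "\<forall>i\<ge>1. b i = cf_pq \<alpha> (i + 1) \<longrightarrow> b (i - 1) = 0"
        using less.prems unfolding ostrowski_adm_def by blast
      from this[rule_format, of "Suc j"] have "b j = 0" using True by simp
      then show ?thesis using True 3 less.IH[of j] less.prems by simp
    next
      case False
      then have "Suc (b (Suc j)) * cf_denom \<alpha> (Suc j) \<le> cf_pq \<alpha> (Suc (Suc j)) * cf_denom \<alpha> (Suc j)"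
        using le by (intro mult_right_mono) auto
      moreover have "(\<Sum>i<Suc j. b i * cf_denom \<alpha> i) < cf_denom \<alpha> (Suc j)"
        using less.IH[of "Suc j"] less.prems 3 by simp
      ultimately show ?thesis using 3 by simp
    qed
  qed (use less.prems in \<open>auto simp: ostrowski_adm_def\<close>)
qed

lemma ostrowski_adm_unique:
  "ostrowski_adm \<alpha> b \<Longrightarrow> ostrowski_adm \<alpha> c \<Longrightarrow> (\<Sum>i<k. b i * cf_denom \<alpha> i) = (\<Sum>i<k. c i * cf_denom \<alpha> i) \<Longrightarrow>
   \<forall>i<k. b i = c i"
proof (induction k)
  case (Suc k)
  have top: "(\<Sum>i<Suc k. d i * cf_denom \<alpha> i) div cf_denom \<alpha> k = d k" if "ostrowski_adm \<alpha> d" for d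
  proof -
    have "cf_denom \<alpha> k \<noteq> 0" using cf_denom_pos[of k] by linarith
    then show ?thesis
      using ostrowski_adm_sum_less[OF that, of k] by (simp only: sum.lessThan_Suc div_mult_self1 div_less) simp
  qed
  have bk: "b k = c k"
    using top[OF Suc.prems(1)] top[OF Suc.prems(2)] unfolding Suc.prems(3) by (rule trans[OF sym])
  have "(\<Sum>i<k. b i * cf_denom \<alpha> i) = (\<Sum>i<k. c i * cf_denom \<alpha> i)"
    using Suc.prems(3) unfolding sum.lessThan_Suc bk by (rule add_right_imp_eq)
  from Suc.IH[OF Suc.prems(1,2) this] bk show ?case unfolding less_Suc_eq by blast
qed simp

lemma ostrowski_adm_exists:
  "n < cf_denom \<alpha> k \<Longrightarrow> \<exists>b. ostrowski_adm \<alpha> b \<and> (\<forall>i\<ge>k. b i = 0) \<and> n = (\<Sum>i<k. b i * cf_denom \<alpha> i)"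
proof (induction k arbitrary: n rule: less_induct)
  case (less k)
  have p1: "cf_pq \<alpha> 1 > 0" using pq_pos[of 1] by simp
  have pS: "cf_pq \<alpha> (Suc i) > 0" for i using pq_pos[of "Suc i"] by simp
  consider "k = 0" | "k = 1" | j where "k = Suc (Suc j)"
    by (cases k; cases "k - 1") auto
  then show ?case
  proof cases
    case 1
    then show ?thesis using less.prems pS p1 by (intro exI[of _ "\<lambda>_. 0"]) (auto simp: ostrowski_adm_def)
  next
    case 2
    have "ostrowski_adm \<alpha> (\<lambda>i. if i = 0 then n else 0)"
      unfolding ostrowski_adm_def
    proof (intro conjI allI impI)
      fix i :: nat
      assume "1 \<le> i" "(if i = 0 then n else 0) = cf_pq \<alpha> (i + 1)"
      then show "(if i - 1 = 0 then n else 0) = 0" using pS[of i] by simp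
    qed (use 2 less.prems in auto)
    then show ?thesis using 2 by (intro exI[of _ "\<lambda>i. if i = 0 then n else 0"]) auto
  next
    case 3
    define Q where "Q = cf_denom \<alpha> (Suc j)"
    define a where "a = cf_pq \<alpha> (Suc (Suc j))"
    define c where "c = n div Q"
    define r where "r = n mod Q"
    have Qpos: "Q > 0" using cf_denom_pos[of "Suc j"] by (simp add: Q_def)
    have n: "n = c * Q + r" by (simp add: c_def r_def)
    have rQ: "r < Q" using Qpos by (simp add: r_def)
    have nlt: "n < a * Q + cf_denom \<alpha> j" using less.prems 3 by (simp add: a_def Q_def)
    then have "n < Suc a * Q" using cf_denom_mono[of j] by (simp add: Q_def)
    then have ca: "c \<le> a" unfolding c_def using Qpos
      by (metis less_Suc_eq_le less_mult_imp_div_less)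
    obtain b where b: "ostrowski_adm \<alpha> b" "\<forall>i\<ge>Suc j. b i = 0" "r = (\<Sum>i<Suc j. b i * cf_denom \<alpha> i)"
        "c = a \<longrightarrow> b j = 0"
    proof (cases "c = a")
      case True
      then have "r < cf_denom \<alpha> j" using n nlt by simp
      from less.IH[OF _ this] 3 obtain b where
        "ostrowski_adm \<alpha> b" "\<forall>i\<ge>j. b i = 0" "r = (\<Sum>i<j. b i * cf_denom \<alpha> i)" by auto
      then show ?thesis using that[of b] by auto
    next
      case False
      from less.IH[of "Suc j" r] 3 rQ obtain b where
        "ostrowski_adm \<alpha> b" "\<forall>i\<ge>Suc j. b i = 0" "r = (\<Sum>i<Suc j. b i * cf_denom \<alpha> i)" by (auto simp: Q_def)
      then show ?thesis using that[of b] False by auto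
    qed
    define d where "d = b(Suc j := c)"
    have d1: "ostrowski_adm \<alpha> d"
      unfolding ostrowski_adm_def
    proof (intro conjI allI impI)
      show "d 0 < cf_pq \<alpha> 1" using b(1) by (simp add: d_def ostrowski_adm_def)
    next
      fix i :: nat assume "1 \<le> i"
      then show "d i \<le> cf_pq \<alpha> (i + 1)" using b(1) ca by (auto simp: d_def ostrowski_adm_def a_def)
    next
      fix i :: nat assume i: "1 \<le> i" "d i = cf_pq \<alpha> (i + 1)"
      show "d (i - 1) = 0"
      proof (cases "i \<le> Suc j")
        case True
        then show ?thesis using i b(1,4) by (cases "i = Suc j") (auto simp: d_def ostrowski_adm_def a_def)
      next
        case False
        then show ?thesis using i b(2) pS[of i] by (auto simp: d_def)
      qed
    qed
    have d2: "\<forall>i\<ge>k. d i = 0" using b(2) 3 by (auto simp: d_def)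
    have "(\<Sum>i<Suc j. d i * cf_denom \<alpha> i) = r"
      unfolding b(3) by (rule sum.cong) (auto simp: d_def)
    then have d3: "n = (\<Sum>i<k. d i * cf_denom \<alpha> i)"
      unfolding 3 sum.lessThan_Suc[of _ "Suc j"] using n by (simp add: d_def Q_def)
    show ?thesis by (intro exI[of _ d] conjI d1 d2 d3)
  qed
qed

lemma ostrowski_rep_ex1: "\<exists>!b. ostrowski_rep \<alpha> n b"
proof -
  have sum_eq: "(\<Sum>i | b i \<noteq> 0. b i * cf_denom \<alpha> i) = (\<Sum>i<k. b i * cf_denom \<alpha> i)"
    if "\<forall>i\<ge>k. b i = 0" for b k
  proof (rule sum.mono_neutral_left)
    show "{i. b i \<noteq> 0} \<subseteq> {..<k}" by (rule subsetI, rule ccontr) (use that in auto)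
  qed auto
  note rep = ostrowski_rep_def
  have "n < cf_denom \<alpha> (Suc n)" using cf_denom_ge[of "Suc n"] by simp
  from ostrowski_adm_exists[OF this] obtain b where
    b: "ostrowski_adm \<alpha> b" "\<forall>i\<ge>Suc n. b i = 0" "n = (\<Sum>i<Suc n. b i * cf_denom \<alpha> i)"
    by (elim exE conjE)
  have fin: "finite {i. b i \<noteq> 0}"
  proof (rule finite_subset)
    show "{i. b i \<noteq> 0} \<subseteq> {..<Suc n}" by (rule subsetI, rule ccontr) (use b(2) in auto)
  qed simp
  have ex: "ostrowski_rep \<alpha> n b"
    unfolding rep sum_eq[OF b(2)] by (intro conjI b(1) fin b(3))
  have uniq: "c = d" if cd: "ostrowski_rep \<alpha> n c" "ostrowski_rep \<alpha> n d" for c d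
  proof -
    have "finite ({i. c i \<noteq> 0} \<union> {i. d i \<noteq> 0})" using cd by (simp only: rep finite_Un simp_thms)
    then obtain k where k: "\<forall>i \<in> {i. c i \<noteq> 0} \<union> {i. d i \<noteq> 0}. i < k"
      unfolding finite_nat_set_iff_bounded by (rule exE)
    have kc: "\<forall>i\<ge>k. c i = 0" using k by (meson UnI1 UnI2 leD mem_Collect_eq)
    have kd: "\<forall>i\<ge>k. d i = 0" using k by (meson UnI1 UnI2 leD mem_Collect_eq)
    have "\<forall>i<k. c i = d i"
    proof (rule ostrowski_adm_unique)
      show "ostrowski_adm \<alpha> c" "ostrowski_adm \<alpha> d" using cd by (simp_all only: rep)
      show "(\<Sum>i<k. c i * cf_denom \<alpha> i) = (\<Sum>i<k. d i * cf_denom \<alpha> i)"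
        using cd unfolding rep sum_eq[OF kc] sum_eq[OF kd] by (elim conjE) (rule trans[OF sym])
    qed
    then have "c i = d i" for i
      using kc kd leI[of i k] by (cases "i < k") simp_all
    then show ?thesis by (rule ext)
  qed
  show ?thesis by (rule ex_ex1I) (rule exI, rule ex, rule uniq, assumption+)
qed

end

lemma ostrowski_rep_ostrowski_digit:
  assumes "m \<ge> 1"
  shows "ostrowski_rep (cf_1m m) n (ostrowski_digit (cf_1m m) n)"
proof -
  have "\<exists>!b. ostrowski_rep (cf_1m m) n b"
    by (rule ostrowski_rep_ex1) (use assms in \<open>simp add: cf_pq_cf_1m\<close>)
  then show ?thesis unfolding ostrowski_digit_def by (rule theI')
qed

end

theory Submission
  imports Defs
begin

text \<open>
  Cut \<open>{0..<N}\<close> into the blocks of integers sharing all Ostrowski digits from position \<open>l\<close> on.  A block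
  starts at some \<open>h\<close> whose digits below \<open>l\<close> vanish and has length \<open>D = q\<^sub>l\<close> or \<open>D = q\<^bsub>l-1\<^esub>\<close>, and
  \<open>S\<^sub>\<alpha>(h + y) = S\<^sub>\<alpha>(h) + S\<^sub>\<alpha>(y)\<close> for \<open>y < D\<close>.  With \<open>Q = q\<^sup>\<kappa> \<ge> q\<^sub>l\<^sup>2\<close>, the inner sum over \<open>y\<close> has, up to
  rare carries, a modulus depending on \<open>h mod Q\<close> only.  Since \<open>h \<alpha>\<close> is within \<open>O(1 / q\<^sub>l)\<close> of an integer
  and \<open>\<alpha>\<close> is badly approximable, every residue class modulo \<open>Q\<close> contains \<open>O(N / (Q q\<^sub>l))\<close> block
  starts.  By Cauchy-Schwarz and Parseval modulo \<open>Q\<close> it remains to save a power in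
  \<open>\<Sum>y<D. e(\<gamma> S\<^sub>\<alpha>(y) + \<beta> y)\<close>, uniformly in \<open>\<beta>\<close>.  These sums satisfy the recurrence of the \<open>q\<^sub>i\<close> twisted by
  the phases \<open>t\<^sub>i = \<gamma> + \<beta> q\<^sub>i\<close>; the coefficient \<open>m\<close> is replaced by a geometric sum in \<open>e(t\<^sub>i)\<close>, \<open>i\<close> odd,
  which is smaller than \<open>m\<close> at least once in three consecutive steps because
  \<open>m \<gamma> = (m + 2) t\<^sub>3 - t\<^sub>1 - t\<^sub>5\<close>, and likewise after shifting the indices by an even number.

  The exponent \<open>\<delta>\<close> may depend on \<open>\<theta>\<close> and \<open>\<gamma>\<close>, so any constant can be traded for \<open>2\<close> by lowering \<open>\<delta>\<close>:
  the trivial bound \<open>N\<close> suffices as long as \<open>N powr \<delta> \<le> 2\<close>.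
\<close>

section \<open>Exponentials and Parseval modulo Q\<close>

lemma expi_cis: "expi x = cis (2 * pi * x)"
  by (simp add: expi_def cis_conv_exp mult_ac)

lemma expi_add: "expi (x + y) = expi x * expi y"
  by (simp add: expi_cis cis_mult ring_distribs)

lemma expi_0 [simp]: "expi 0 = 1"
  by (simp add: expi_cis)

lemma norm_expi [simp]: "cmod (expi x) = 1"
  by (simp add: expi_cis)

lemma cnj_expi: "cnj (expi x) = expi (- x)"
  by (simp add: expi_cis cis_cnj)

lemma expi_of_nat_mult: "expi (real n * x) = expi x ^ n"
  by (simp add: expi_cis Complex.DeMoivre mult_ac)

lemma expi_eq_1_iff: "expi x = 1 \<longleftrightarrow> x \<in> \<int>"
proof -
  have "expi x = 1 \<longleftrightarrow> (\<exists>n::int. 2 * pi * x = of_int n * (2 * pi))"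
    unfolding expi_cis cis_conv_exp exp_eq_1 by (simp add: mult_ac)
  also have "\<dots> \<longleftrightarrow> (\<exists>n::int. x = of_int n)" by (intro ex_cong1) auto
  also have "\<dots> \<longleftrightarrow> x \<in> \<int>" by (auto elim: Ints_cases)
  finally show ?thesis .
qed

text \<open>The chord length |e(x) - 1| stands in for the distance of x to the nearest integer: it
  is subadditive, even, and zero exactly on the integers.\<close>

lemma norm_expi_add_minus_1_le:
  "cmod (expi (x + y) - 1) \<le> cmod (expi x - 1) + cmod (expi y - 1)"
proof -
  have "expi (x + y) - 1 = expi x * (expi y - 1) + (expi x - 1)"
    by (simp add: expi_add algebra_simps)
  also have "cmod \<dots> \<le> cmod (expi x * (expi y - 1)) + cmod (expi x - 1)"
    by (rule norm_triangle_ineq)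
  finally show ?thesis by (simp add: norm_mult)
qed

lemma norm_expi_uminus_minus_1: "cmod (expi (- x) - 1) = cmod (expi x - 1)"
proof -
  have "expi (- x) - 1 = cnj (expi x - 1)" by (simp add: cnj_expi)
  then show ?thesis by (simp only: complex_mod_cnj)
qed

lemma norm_expi_mult_minus_1_le: "cmod (expi (real n * x) - 1) \<le> real n * cmod (expi x - 1)"
proof (induction n)
  case (Suc n)
  have "cmod (expi (real (Suc n) * x) - 1) \<le> cmod (expi (real n * x) - 1) + cmod (expi x - 1)"
    using norm_expi_add_minus_1_le[of "real n * x" x] by (simp add: algebra_simps)
  with Suc show ?case by (simp add: algebra_simps)
qed simp

text \<open>The parallelogram law gives \<open>|1 + e(t)|\<^sup>2 = 4 - |e(t) - 1|\<^sup>2\<close>.\<close>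

lemma norm_geometric_expi_le:
  assumes "m \<ge> 2" "\<epsilon> \<ge> 0" "\<epsilon> \<le> cmod (expi t - 1)"
  shows "cmod (\<Sum>b<m. expi (real b * t)) \<le> real m - \<epsilon>\<^sup>2 / 4"
proof -
  obtain k where m: "m = Suc (Suc k)"
    by (rule that[of "m - 2"]) (use assms(1) in simp)
  let ?z = "expi t"
  have par: "(cmod (1 + ?z))\<^sup>2 = 4 - (cmod (?z - 1))\<^sup>2"
  proof -
    have "(Re ?z)\<^sup>2 + (Im ?z)\<^sup>2 = 1" using norm_expi[of t] by (simp flip: cmod_power2)
    moreover have "(cmod (1 + ?z))\<^sup>2 = (Re ?z)\<^sup>2 + (Im ?z)\<^sup>2 + 1 + 2 * Re ?z"
      "(cmod (?z - 1))\<^sup>2 = (Re ?z)\<^sup>2 + (Im ?z)\<^sup>2 + 1 - 2 * Re ?z"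
      unfolding cmod_power2 by (simp_all add: power2_sum power2_diff)
    ultimately show ?thesis by linarith
  qed
  have le2: "cmod (?z - 1) \<le> 2" using norm_triangle_ineq4[of ?z 1] by simp
  have eps: "\<epsilon> ^ 2 \<le> (cmod (?z - 1))\<^sup>2" using assms by (intro power_mono) auto
  have "\<epsilon>\<^sup>2 \<le> 2\<^sup>2" using assms le2 by (intro power_mono) auto
  then have pos: "2 - \<epsilon>\<^sup>2 / 4 \<ge> 0" by simp
  have "(cmod (1 + ?z))\<^sup>2 \<le> (2 - \<epsilon>\<^sup>2 / 4)\<^sup>2"
  proof -
    have "(2 - x / 4)\<^sup>2 = 4 - x + (x / 4)\<^sup>2" for x :: real
      by (simp add: power2_eq_square algebra_simps)
    from this[of "\<epsilon>\<^sup>2"] show ?thesis using par eps zero_le_power2[of "\<epsilon>\<^sup>2 / 4"] by linarith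
  qed
  then have a: "cmod (1 + ?z) \<le> 2 - \<epsilon>\<^sup>2 / 4" using pos by (rule power2_le_imp_le)
  \<comment> \<open>Only the first two terms are paired, saving
    \<open>\<epsilon>\<^sup>2 / 4\<close>; the other m - 2 terms are bounded trivially.\<close>
  have "(\<Sum>b<m. expi (real b * t)) = (1 + ?z) + (\<Sum>b<k. expi (real (Suc (Suc b)) * t))"
    unfolding m sum.lessThan_Suc_shift by simp
  also have "cmod \<dots> \<le> (2 - \<epsilon>\<^sup>2 / 4) + (\<Sum>b<k. 1)"
    by (intro order_trans[OF norm_triangle_ineq] add_mono[OF a] sum_norm_le) simp
  finally show ?thesis using m by simp
qed

lemma sum_expi_orthogonal:
  assumes "Q > 0" "z < Q" "z' < Q"
  shows "(\<Sum>k<Q. expi (real k * (real z' - real z) / real Q)) = (if z = z' then of_nat Q else 0)"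
proof (cases "z = z'")
  case False
  define x where "x = (real z' - real z) / real Q"
  have "x \<notin> \<int>"
  proof
    assume "x \<in> \<int>"
    then obtain i where "x = of_int i" by (auto elim: Ints_cases)
    then have "real_of_int (int z' - int z) = real_of_int (i * int Q)"
      using assms(1) by (simp add: x_def field_simps)
    then have e: "int z' - int z = i * int Q" by (simp only: of_int_eq_iff)
    have "i \<noteq> 0" using e False by auto
    then have "\<bar>i * int Q\<bar> \<ge> 1 * int Q" unfolding abs_mult by (intro mult_mono) auto
    then show False using e assms by linarith
  qed
  then have ne: "expi x \<noteq> 1" by (simp add: expi_eq_1_iff)
  have "(\<Sum>k<Q. expi (real k * (real z' - real z) / real Q)) = (\<Sum>k<Q. expi x ^ k)"
    by (intro sum.cong refl) (simp add: expi_of_nat_mult [symmetric] x_def)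
  also have "\<dots> = 0"
  proof -
    have "expi x ^ Q = expi (real_of_int (int z' - int z))"
      using assms(1) by (simp add: expi_of_nat_mult [symmetric] x_def)
    also have "\<dots> = 1" unfolding expi_eq_1_iff by (rule Ints_of_int)
    finally show ?thesis using ne by (simp add: geometric_sum)
  qed
  finally show ?thesis using False by simp
qed simp

section \<open>Fourier transform modulo Q and cyclic convolution\<close>

definition dft :: "nat \<Rightarrow> (nat \<Rightarrow> complex) \<Rightarrow> nat \<Rightarrow> complex" where
  "dft Q F k = (\<Sum>z<Q. F z * expi (- (real k * real z / real Q)))"

text \<open>The transform is unnormalised, hence the factor \<open>Q\<close>. Summing over the
  frequency first leaves only the diagonal, by orthogonality.\<close>

lemma parseval_dft:
  assumes "Q > 0"
  shows "(\<Sum>k<Q. (cmod (dft Q F k))\<^sup>2) = real Q * (\<Sum>z<Q. (cmod (F z))\<^sup>2)"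
proof -
  have "complex_of_real (\<Sum>k<Q. (cmod (dft Q F k))\<^sup>2) = (\<Sum>k<Q. dft Q F k * cnj (dft Q F k))"
    by (simp add: complex_norm_square del: of_real_power)
  also have "\<dots> = (\<Sum>k<Q. \<Sum>z<Q. \<Sum>z'<Q. F z * cnj (F z') * expi (real k * (real z' - real z) / real Q))"
    unfolding dft_def cnj_sum sum_product
  proof (intro sum.cong refl)
    fix k z z'
    have e: "expi (- (real k * real z / real Q)) * expi (real k * real z' / real Q) =
        expi (real k * (real z' - real z) / real Q)"
      unfolding expi_add [symmetric] by (simp add: right_diff_distrib diff_divide_distrib)
    show "F z * expi (- (real k * real z / real Q)) * cnj (F z' * expi (- (real k * real z' / real Q))) =
        F z * cnj (F z') * expi (real k * (real z' - real z) / real Q)"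
      unfolding e [symmetric] by (simp add: cnj_expi)
  qed
  also have "\<dots> = (\<Sum>z<Q. \<Sum>z'<Q. \<Sum>k<Q. F z * cnj (F z') * expi (real k * (real z' - real z) / real Q))"
    by (rule trans[OF sum.swap sum.cong[OF refl sum.swap]])
  also have "\<dots> = (\<Sum>z<Q. \<Sum>z'<Q. F z * cnj (F z') * (if z = z' then of_nat Q else 0))"
    using assms by (intro sum.cong refl) (simp add: sum_expi_orthogonal flip: sum_distrib_left)
  also have "\<dots> = (\<Sum>z<Q. F z * cnj (F z) * of_nat Q)"
    by (intro sum.cong refl) (simp add: if_distrib cong: if_cong)
  also have "\<dots> = complex_of_real (real Q * (\<Sum>z<Q. (cmod (F z))\<^sup>2))"
    by (simp add: complex_norm_square sum_distrib_left mult_ac del: of_real_power)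
  finally show ?thesis by (simp only: of_real_eq_iff)
qed

lemma bij_betw_add_mod:
  assumes "(Q::nat) > 0"
  shows "bij_betw (\<lambda>x. (x + y) mod Q) {..<Q} {..<Q}"
proof -
  have "inj_on (\<lambda>x. (x + y) mod Q) {..<Q}"
  proof (rule inj_onI)
    fix a b assume ab: "a \<in> {..<Q}" "b \<in> {..<Q}" "(a + y) mod Q = (b + y) mod Q"
    then have "int Q dvd (int a + int y) - (int b + int y)"
      by (metis mod_eq_dvd_iff of_nat_add of_nat_mod)
    then have "int Q dvd int a - int b" by simp
    then have "int a mod int Q = int b mod int Q" by (simp add: mod_eq_dvd_iff)
    then show "a = b" using ab by simp
  qed
  moreover have "(\<lambda>x. (x + y) mod Q) ` {..<Q} \<subseteq> {..<Q}" using assms by auto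
  ultimately show ?thesis by (simp add: bij_betw_def endo_inj_surj)
qed

lemma expi_mod:
  assumes "Q > 0"
  shows "expi (- (real k * real (x mod Q) / real Q)) = expi (- (real k * real x / real Q))"
proof -
  have "real x = real (x div Q) * real Q + real (x mod Q)"
    by (metis div_mult_mod_eq of_nat_add of_nat_mult)
  then have "- (real k * real (x mod Q) / real Q) = - (real k * real x / real Q) + real (k * (x div Q))"
    using assms by (simp add: field_simps)
  moreover have "expi (real (k * (x div Q))) = 1" unfolding expi_eq_1_iff by (rule Ints_of_nat)
  ultimately show ?thesis by (simp only: expi_add) simp
qed

text \<open>The inner sum is a cyclic correlation in \<open>x\<close>, so its transform is that of
  \<open>F\<close> times the exponential sum of \<open>g\<close> at frequency k / Q, which is at
  most \<open>B\<close>. Parseval in both directions and Cauchy-Schwarz give the claim; for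
  unimodular \<open>g\<close> the trivial bound would have \<open>D\<close> in place of
  \<open>B\<close>.\<close>

lemma sum_norm_convolution_le:
  fixes F g :: "nat \<Rightarrow> complex"
  assumes Q: "Q > 0" and F: "\<And>z. cmod (F z) \<le> 1" and B: "\<And>\<beta>. cmod (\<Sum>y<D. g y * expi (\<beta> * real y)) \<le> B"
  shows "(\<Sum>x<Q. cmod (\<Sum>y<D. F ((x + y) mod Q) * g y)) \<le> real Q * B"
proof -
  define W where "W x = (\<Sum>y<D. F ((x + y) mod Q) * g y)" for x
  have B0: "B \<ge> 0" using norm_ge_zero B[of 0] by (rule order_trans)
  have dW: "dft Q W k = (\<Sum>y<D. g y * expi (real k / real Q * real y)) * dft Q F k" for k
  proof -
    have "dft Q W k = (\<Sum>y<D. \<Sum>x<Q. F ((x + y) mod Q) * g y * expi (- (real k * real x / real Q)))"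
      unfolding dft_def W_def sum_distrib_right by (rule sum.swap)
    \<comment> \<open>Shift x by y; the character has period Q, so its argument may be reduced
      modulo Q.\<close>
    also have "\<dots> = (\<Sum>y<D. g y * expi (real k / real Q * real y) *
        (\<Sum>x<Q. F ((x + y) mod Q) * expi (- (real k * real ((x + y) mod Q) / real Q))))"
      unfolding sum_distrib_left expi_mod[OF Q]
    proof (intro sum.cong refl)
      fix y x
      have "expi (- (real k * real x / real Q)) =
          expi (real k / real Q * real y) * expi (- (real k * real (x + y) / real Q))"
        unfolding expi_add [symmetric] using Q by (simp add: field_simps)
      then show "F ((x + y) mod Q) * g y * expi (- (real k * real x / real Q)) =
        g y * expi (real k / real Q * real y) *
          (F ((x + y) mod Q) * expi (- (real k * real (x + y) / real Q)))"
        by (simp add: mult_ac)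
    qed
    also have "\<dots> = (\<Sum>y<D. g y * expi (real k / real Q * real y) * dft Q F k)"
      unfolding dft_def
      by (intro sum.cong refl arg_cong2[where f = "(*)"] sum.reindex_bij_betw[OF bij_betw_add_mod[OF Q]])
    finally show ?thesis by (simp add: sum_distrib_right)
  qed
  have "real Q * (\<Sum>x<Q. (cmod (W x))\<^sup>2) = (\<Sum>k<Q. (cmod (dft Q W k))\<^sup>2)"
    by (rule parseval_dft[OF Q, symmetric])
  also have "\<dots> \<le> (\<Sum>k<Q. B\<^sup>2 * (cmod (dft Q F k))\<^sup>2)"
    unfolding dW norm_mult power_mult_distrib
    by (intro sum_mono mult_right_mono power_mono B) auto
  also have "\<dots> = B\<^sup>2 * (real Q * (\<Sum>z<Q. (cmod (F z))\<^sup>2))"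
    by (simp add: sum_distrib_left [symmetric] parseval_dft[OF Q])
  also have "\<dots> \<le> B\<^sup>2 * (real Q * (\<Sum>z<Q. 1))"
    using F by (intro mult_left_mono sum_mono power_le_one) auto
  finally have "real Q * (\<Sum>x<Q. (cmod (W x))\<^sup>2) \<le> (real Q * B)\<^sup>2"
    by (simp add: power2_eq_square mult_ac)
  moreover have "(\<Sum>x<Q. cmod (W x))\<^sup>2 \<le> real Q * (\<Sum>x<Q. (cmod (W x))\<^sup>2)"
    using sum_squared_le_sum_of_squares[of "\<lambda>x. cmod (W x)" "{..<Q}"] by (simp add: mult_ac)
  ultimately have "(\<Sum>x<Q. cmod (W x))\<^sup>2 \<le> (real Q * B)\<^sup>2" by linarith
  then show ?thesis unfolding W_def by (rule power2_le_imp_le) (simp add: B0)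
qed

section \<open>Digit sums and block starts in residue classes\<close>

lemma sum_lessThan_add:
  fixes f :: "nat \<Rightarrow> 'a::comm_monoid_add"
  shows "(\<Sum>i<k + n. f i) = (\<Sum>i<k. f i) + (\<Sum>i<n. f (k + i))"
  by (induction n) (auto simp: add.assoc)

lemma digit_sum_eq_sum:
  assumes "n < q ^ k" "q \<ge> 2"
  shows "digit_sum q n = (\<Sum>i<k. n div q ^ i mod q)"
  unfolding digit_sum_def
proof (rule sum.mono_neutral_left)
  show "{i. n div q ^ i mod q \<noteq> 0} \<subseteq> {..<k}"
  proof (rule subsetI, rule ccontr)
    fix i assume i: "i \<in> {i. n div q ^ i mod q \<noteq> 0}" "i \<notin> {..<k}"
    then have "q ^ k \<le> q ^ i" using assms by (intro power_increasing) auto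
    then have "n div q ^ i = 0" using assms by (intro div_less) linarith
    then show False using i by simp
  qed
qed auto

text \<open>Since \<open>z\<close> occupies only the lowest k positions, the two digit strings are
  concatenated without carries.\<close>

lemma digit_sum_add:
  assumes "q \<ge> 2" "z < q ^ k"
  shows "digit_sum q (a * q ^ k + z) = digit_sum q a + digit_sum q z"
proof -
  \<comment> \<open>A crude digit count: k + a positions hold all digits of the sum.\<close>
  have qa: "a < q ^ a" using assms by (intro less_exp[THEN less_le_trans] power_mono) auto
  have "a * q ^ k + z < Suc a * q ^ k" using assms by simp
  also have "\<dots> \<le> q ^ a * q ^ k" using qa by (intro mult_right_mono) auto
  finally have lt: "a * q ^ k + z < q ^ (k + a)" by (simp add: power_add mult.commute)
  have "digit_sum q (a * q ^ k + z) = (\<Sum>i<k + a. (a * q ^ k + z) div q ^ i mod q)"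
    by (rule digit_sum_eq_sum[OF lt assms(1)])
  also have "\<dots> = (\<Sum>i<k. (a * q ^ k + z) div q ^ i mod q) + (\<Sum>i<a. (a * q ^ k + z) div q ^ (k + i) mod q)"
    by (rule sum_lessThan_add)
  also have "(\<Sum>i<a. (a * q ^ k + z) div q ^ (k + i) mod q) = (\<Sum>i<a. a div q ^ i mod q)"
  proof (intro sum.cong refl)
    fix i
    have "(a * q ^ k + z) div q ^ k = a" using assms by simp
    then show "(a * q ^ k + z) div q ^ (k + i) mod q = a div q ^ i mod q"
      by (simp only: power_add div_mult2_eq)
  qed
  also have "(\<Sum>i<k. (a * q ^ k + z) div q ^ i mod q) = (\<Sum>i<k. z div q ^ i mod q)"
  proof (intro sum.cong refl)
    fix i assume "i \<in> {..<k}"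
    then obtain j where "k = i + Suc j" by (auto dest: less_imp_Suc_add)
    then have "a * q ^ k + z = (a * q ^ j * q) * q ^ i + z" by (simp add: power_add)
    moreover have "q ^ i \<noteq> 0" using assms by simp
    ultimately have "(a * q ^ k + z) div q ^ i = a * q ^ j * q + z div q ^ i"
      by (metis div_mult_self3)
    then show "(a * q ^ k + z) div q ^ i mod q = z div q ^ i mod q" by simp
  qed
  finally show ?thesis using digit_sum_eq_sum[OF assms(2,1)] digit_sum_eq_sum[OF qa assms(1)] by simp
qed

section \<open>Members of a residue class whose multiples of \<alpha> are near integers\<close>

lemma card_ints_near_le:
  fixes f :: "nat \<Rightarrow> int" and c w :: real
  assumes inj: "inj_on f I" and near: "\<And>i. i \<in> I \<Longrightarrow> \<bar>c + of_int (f i)\<bar> \<le> w" and "w \<ge> 0"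
  shows "real (card I) \<le> 2 * w + 1"
proof -
  have "f ` I \<subseteq> {\<lceil>- c - w\<rceil>..\<lfloor>- c + w\<rfloor>}"
  proof
    fix u assume "u \<in> f ` I"
    then have "\<bar>c + of_int u\<bar> \<le> w" using near by auto
    then have "- c - w \<le> of_int u" "of_int u \<le> - c + w" by linarith+
    then show "u \<in> {\<lceil>- c - w\<rceil>..\<lfloor>- c + w\<rfloor>}" by (simp add: ceiling_le_iff le_floor_iff)
  qed
  then have "card (f ` I) \<le> card {\<lceil>- c - w\<rceil>..\<lfloor>- c + w\<rfloor>}" by (intro card_mono) auto
  then have "real (card I) \<le> real (nat (\<lfloor>- c + w\<rfloor> - \<lceil>- c - w\<rceil> + 1))"
    using inj by (simp add: card_image)
  also have "\<dots> \<le> 2 * w + 1"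
  proof (cases "\<lfloor>- c + w\<rfloor> - \<lceil>- c - w\<rceil> + 1 \<ge> 0")
    case True
    have "real_of_int (\<lfloor>- c + w\<rfloor> - \<lceil>- c - w\<rceil> + 1) \<le> 2 * w + 1"
      using of_int_floor_le[of "- c + w"] le_of_int_ceiling[of "- c - w"] by simp linarith
    then show ?thesis using True by simp
  qed (use \<open>w \<ge> 0\<close> in simp)
  finally show ?thesis .
qed

text \<open>In a window of \<open>s\<close> consecutive integers, the multiples of \<open>\<beta> \<approx> p / s\<close> are close to the
  \<open>s\<close> distinct points of \<open>\<int> / s\<close> modulo one.\<close>

lemma card_window_le:
  fixes \<beta> c r T :: real and s :: nat and p :: int
  assumes s: "s > 0" and cop: "coprime p (int s)" and app: "\<bar>real s * \<beta> - of_int p\<bar> \<le> 1 / T" and T: "T > 0"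
    and r: "r \<ge> 0" and I: "I \<subseteq> {..<s}"
    and near: "\<And>i. i \<in> I \<Longrightarrow> \<exists>z::int. \<bar>c + real i * \<beta> - of_int z\<bar> \<le> r"
  shows "real (card I) \<le> 2 * (real s * r + real s / T) + 1"
proof -
  from near obtain z :: "nat \<Rightarrow> int" where z: "\<And>i. i \<in> I \<Longrightarrow> \<bar>c + real i * \<beta> - of_int (z i)\<bar> \<le> r"
    by metis
  \<comment> \<open>Multiplying c + i \<beta> - z_i by s and replacing s \<beta> by p gives s c +
    u_i, up to an additional error of at most i / T. Modulo s, u_i is i p, so coprimality makes
    \<open>u\<close> injective on the window.\<close>
  define u where "u i = int i * p - int s * z i" for i
  have "inj_on u I"
  proof (rule inj_onI)
    fix i j assume ij: "i \<in> I" "j \<in> I" "u i = u j"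
    then have "(int i - int j) * p = int s * (z i - z j)" by (simp add: u_def algebra_simps)
    then have "int s dvd (int i - int j) * p" by simp
    then have "int s dvd int i - int j"
      using cop by (simp add: coprime_dvd_mult_left_iff coprime_commute)
    then have "int i mod int s = int j mod int s" by (simp add: mod_eq_dvd_iff)
    moreover have "i < s" "j < s" using ij I by auto
    ultimately show "i = j" by simp
  qed
  moreover have "\<bar>real s * c + of_int (u i)\<bar> \<le> real s * r + real s / T" if i: "i \<in> I" for i
  proof -
    have "real s * c + of_int (u i) =
        real s * (c + real i * \<beta> - of_int (z i)) - real i * (real s * \<beta> - of_int p)"
      by (simp add: u_def algebra_simps)
    also have "\<bar>\<dots>\<bar> \<le> real s * \<bar>c + real i * \<beta> - of_int (z i)\<bar> + real i * \<bar>real s * \<beta> - of_int p\<bar>"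
      by (rule order_trans[OF abs_triangle_ineq4]) (simp add: abs_mult)
    also have "\<dots> \<le> real s * r + real s * (1 / T)"
      using i I z[OF i] app T by (intro add_mono mult_mono) auto
    finally show ?thesis by simp
  qed
  ultimately show ?thesis using r T by (intro card_ints_near_le) auto
qed

text \<open>Write h = j Q + x and let p / s be a Dirichlet approximation of Q a with s <= T. Each
  window of s consecutive j contains O(s / L) members as soon as s >= L, and bad approximability
  supplies this lower bound.\<close>

lemma card_residue_class_near_le:
  fixes a L \<kappa> :: real and N Q T x :: nat
  assumes L: "L \<ge> 1" and Q: "Q > 0" and \<kappa>: "\<kappa> > 0"
    and bad: "\<And>n p. n > 0 \<Longrightarrow> 1 \<le> \<kappa> * real n * \<bar>real n * a - of_int (p::int)\<bar>"
    and T: "\<kappa> * real Q * L \<le> real T" and N: "Q * T \<le> N"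
    and X: "\<And>h. h \<in> X \<Longrightarrow> h < N \<and> h mod Q = x \<and> (\<exists>z::int. \<bar>real h * a - of_int z\<bar> \<le> 2 / L)"
  shows "real (card X) \<le> 14 * real N / (real Q * L)"
proof -
  have Tpos: "T > 0"
  proof -
    have "0 < \<kappa> * real Q * L" using L Q \<kappa> by simp
    then show ?thesis using T by (metis of_nat_0_less_iff order_less_le_trans)
  qed
  obtain p k where pk: "coprime p k" "0 < k" "k \<le> int T" "\<bar>of_int k * (real Q * a) - of_int p\<bar> < 1 / real T"
    using Dirichlet_approx_coprime[OF Tpos, of "real Q * a"] by metis
  define s where "s = nat k"
  have k: "k = int s" using pk by (simp add: s_def)
  have s0: "s > 0" and sT: "s \<le> T" using pk k by auto
  have app: "\<bar>real s * (real Q * a) - of_int p\<bar> < 1 / real T" using pk(4) k by simp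
  have sL: "L \<le> real s"
  proof -
    \<comment> \<open>Bad approximability at the denominator s Q gives T <= \<kappa> Q s, so the
      choice of T forces s >= L.\<close>
    have "1 \<le> \<kappa> * real (s * Q) * \<bar>real (s * Q) * a - of_int p\<bar>"
      by (rule bad) (use s0 Q in simp)
    also have "\<dots> \<le> \<kappa> * real (s * Q) * (1 / real T)"
      using app \<kappa> by (intro mult_left_mono) (simp_all add: mult.assoc)
    finally have "real T \<le> \<kappa> * real Q * real s" using Tpos by (simp add: field_simps)
    with T have "\<kappa> * real Q * L \<le> \<kappa> * real Q * real s" by linarith
    moreover have "\<kappa> * real Q > 0" using \<kappa> Q by simp
    ultimately show ?thesis by (simp only: mult_le_cancel_left_pos)
  qed
  have finX: "finite X" by (rule finite_subset[of _ "{..<N}"]) (use X in auto)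
  define J where "J = (\<lambda>h. h div Q) ` X"
  have cardJ: "card J = card X"
    unfolding J_def by (intro card_image inj_onI) (metis X div_mult_mod_eq)
  have finJ: "finite J" using finX by (simp add: J_def)
  have Jx: "j * Q + x < N" "\<exists>z::int. \<bar>real (j * Q + x) * a - of_int z\<bar> \<le> 2 / L" if j: "j \<in> J" for j
  proof -
    obtain h where "h \<in> X" "j = h div Q" using j by (auto simp: J_def)
    then have "h \<in> X" "j * Q + x = h" using X[of h] by (metis div_mult_mod_eq)+
    then show "j * Q + x < N" "\<exists>z::int. \<bar>real (j * Q + x) * a - of_int z\<bar> \<le> 2 / L" using X[of h] by auto
  qed
  \<comment> \<open>The number of windows; the successor accounts for the last, incomplete
    one.\<close>
  define M where "M = Suc (N div (Q * s))"
  have wM: "(\<lambda>j. j div s) ` J \<subseteq> {..<M}"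
  proof
    fix w assume "w \<in> (\<lambda>j. j div s) ` J"
    then obtain j where j: "j \<in> J" "w = j div s" by auto
    then have "j * Q \<le> N" using Jx(1) by fastforce
    then have "j \<le> N div Q" using Q by (simp add: less_eq_div_iff_mult_less_eq)
    then have "w \<le> N div Q div s" unfolding j(2) by (rule div_le_mono)
    then show "w \<in> {..<M}" by (simp add: M_def div_mult2_eq)
  qed
  have win: "real (card {j \<in> J. j div s = w}) \<le> 7 * real s / L" for w
  proof -
    define I where "I = (\<lambda>j. j mod s) ` {j \<in> J. j div s = w}"
    have "card I = card {j \<in> J. j div s = w}"
      unfolding I_def by (intro card_image inj_onI) (metis (mono_tags, lifting) div_mult_mod_eq mem_Collect_eq)
    \<comment> \<open>This is 4 s / L + 2 s / T + 1, at most 7 s / L because s / T <= 1 <= s /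
      L.\<close>
    moreover have "real (card I) \<le> 2 * (real s * (2 / L) + real s / real T) + 1"
    proof (rule card_window_le[where c = "real (w * s * Q + x) * a"])
      show "coprime p (int s)" using pk k by simp
      show "\<bar>real s * (real Q * a) - of_int p\<bar> \<le> 1 / real T" using app by simp
      show "I \<subseteq> {..<s}" using s0 by (auto simp: I_def)
      fix i assume "i \<in> I"
      then obtain j where j: "j \<in> J" "j div s = w" "i = j mod s" by (auto simp: I_def)
      then have "j = w * s + i" by (metis div_mult_mod_eq)
      then have "real (w * s * Q + x) * a + real i * (real Q * a) = real (j * Q + x) * a"
        by (simp add: algebra_simps)
      then show "\<exists>z::int. \<bar>real (w * s * Q + x) * a + real i * (real Q * a) - of_int z\<bar> \<le> 2 / L"
        using Jx(2)[OF j(1)] by simp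
    qed (use s0 Tpos L in auto)
    moreover have "real s / real T \<le> 1" using sT Tpos by simp
    moreover have "1 \<le> real s / L" using sL L by simp
    ultimately show ?thesis by simp
  qed
  have "real (card J) = (\<Sum>w\<in>(\<lambda>j. j div s) ` J. real (card {j \<in> J. j div s = w}))"
    using sum.image_gen[OF finJ, of "\<lambda>_. 1::real" "\<lambda>j. j div s"] by simp
  also have "\<dots> \<le> (\<Sum>w<M. real (card {j \<in> J. j div s = w}))"
    by (intro sum_mono2 wM) auto
  also have "\<dots> \<le> (\<Sum>w<M. 7 * real s / L)" by (intro sum_mono win)
  also have "\<dots> = real M * (7 * real s / L)" by simp
  \<comment> \<open>As Q s <= Q T <= N, the extra window costs at most a factor 2.\<close>
  also have "\<dots> \<le> (2 * (real N / (real Q * real s))) * (7 * real s / L)"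
  proof (rule mult_right_mono)
    have "Q * s \<le> N" using N sT by (meson le_trans mult_le_mono2)
    then have "1 \<le> real N / (real Q * real s)"
      using Q s0 by (simp flip: of_nat_mult)
    moreover have "real (N div (Q * s)) \<le> real N / (real Q * real s)"
    proof -
      have "real (N div (Q * s)) * real (Q * s) \<le> real N"
        by (simp only: of_nat_mult [symmetric] of_nat_le_iff div_times_less_eq_dividend)
      then show ?thesis using Q s0 by (simp add: pos_le_divide_eq)
    qed
    ultimately show "real M \<le> 2 * (real N / (real Q * real s))" by (simp add: M_def)
  qed (use L in simp)
  also have "\<dots> = 14 * real N / (real Q * L)" using s0 by (simp add: field_simps)
  finally show ?thesis by (simp add: cardJ)
qed

section \<open>Ostrowski representations\<close>

locale ostrowski =
  fixes \<alpha> :: real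
  assumes pq_pos: "\<And>i. i \<ge> 1 \<Longrightarrow> cf_pq \<alpha> i \<ge> 1"
begin

abbreviation "den \<equiv> cf_denom \<alpha>"
abbreviation "dig \<equiv> ostrowski_digit \<alpha>"
abbreviation "pq \<equiv> cf_pq \<alpha>"

lemma den_pos [simp]: "den i > 0"
  using cf_denom_pos[OF pq_pos, of i] by simp

lemma den_mono: "i \<le> j \<Longrightarrow> den i \<le> den j"
  by (rule lift_Suc_mono_le[of den]) (rule cf_denom_mono[OF pq_pos])

lemma ostrowski_repI:
  assumes "ostrowski_adm \<alpha> b" "\<And>i. i \<ge> k \<Longrightarrow> b i = 0"
  shows "ostrowski_rep \<alpha> (\<Sum>i<k. b i * den i) b"
proof -
  have "i < k" if "b i \<noteq> 0" for i using assms(2)[of i] that by (cases "i < k") auto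
  then have sub: "{i. b i \<noteq> 0} \<subseteq> {..<k}" by auto
  then have "(\<Sum>i<k. b i * den i) = (\<Sum>i | b i \<noteq> 0. b i * den i)"
    by (intro sum.mono_neutral_right) auto
  then show ?thesis using assms(1) finite_subset[OF sub] by (simp add: ostrowski_rep_def)
qed

lemma dig_eqI: "ostrowski_rep \<alpha> n b \<Longrightarrow> dig n = b"
  unfolding ostrowski_digit_def by (rule the1_equality[OF ostrowski_rep_ex1[OF pq_pos]])

lemma ostrowski_rep_dig: "ostrowski_rep \<alpha> n (dig n)"
  unfolding ostrowski_digit_def by (rule theI'[OF ostrowski_rep_ex1[OF pq_pos]])

lemma adm_dig: "ostrowski_adm \<alpha> (dig n)"
  using ostrowski_rep_dig by (simp add: ostrowski_rep_def)

lemma finite_dig: "finite {i. dig n i \<noteq> 0}"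
  using ostrowski_rep_dig by (simp add: ostrowski_rep_def)

lemma sum_dig: "n = (\<Sum>i | dig n i \<noteq> 0. dig n i * den i)"
  using ostrowski_rep_dig[of n] by (simp add: ostrowski_rep_def)

lemma dig_le: "i \<ge> 1 \<Longrightarrow> dig n i \<le> pq (Suc i)"
  using adm_dig[of n] by (simp add: ostrowski_adm_def)

lemma dig_eq_pqD: "dig n (Suc i) = pq (Suc (Suc i)) \<Longrightarrow> dig n i = 0"
  using adm_dig[of n] by (auto simp: ostrowski_adm_def dest: spec[of _ "Suc i"])

lemma dig_eq_0:
  assumes "n < den l" "i \<ge> l"
  shows "dig n i = 0"
proof (rule ccontr)
  assume nz: "dig n i \<noteq> 0"
  have "den i \<le> dig n i * den i" using nz by simp
  also have "\<dots> \<le> (\<Sum>i | dig n i \<noteq> 0. dig n i * den i)"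
    using nz finite_dig by (intro member_le_sum) auto
  finally show False using sum_dig[of n] den_mono[OF assms(2)] assms(1) by linarith
qed

text \<open>A cut-off beyond all nonzero digits and beyond a prescribed l lets several
  representations be summed over one range.\<close>

lemma obtain_digs:
  obtains k where "l \<le> k" "\<And>i. i \<ge> k \<Longrightarrow> dig n i = 0" "n = (\<Sum>i<k. dig n i * den i)"
    "ostrowski_sum \<alpha> n = (\<Sum>i<k. dig n i)"
proof -
  have "n < den (n + l + 1)"
    using cf_denom_ge[OF pq_pos, of "n + l + 1"] by simp
  then have z: "dig n i = 0" if "i \<ge> n + l + 1" for i using that by (rule dig_eq_0)
  have "i < n + l + 1" if "dig n i \<noteq> 0" for i using z[of i] that by (cases "i < n + l + 1") auto
  then have sub: "{i. dig n i \<noteq> 0} \<subseteq> {..<n + l + 1}" by auto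
  show thesis
  proof (rule that[of "n + l + 1"])
    have "n = (\<Sum>i | dig n i \<noteq> 0. dig n i * den i)" by (rule sum_dig)
    also have "\<dots> = (\<Sum>i<n + l + 1. dig n i * den i)"
      using sub by (intro sum.mono_neutral_left) auto
    finally show "n = (\<Sum>i<n + l + 1. dig n i * den i)" .
    show "ostrowski_sum \<alpha> n = (\<Sum>i<n + l + 1. dig n i)"
      unfolding ostrowski_sum_def using sub by (intro sum.mono_neutral_left) auto
  qed (use z in auto)
qed

lemma dig_less_den:
  assumes "n < den l"
  shows "n = (\<Sum>i<l. dig n i * den i)"
proof -
  obtain k where k: "l \<le> k" "\<And>i. i \<ge> k \<Longrightarrow> dig n i = 0" "n = (\<Sum>i<k. dig n i * den i)"
    "ostrowski_sum \<alpha> n = (\<Sum>i<k. dig n i)" by (rule obtain_digs[of l n]) blast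
  have "(\<Sum>i<l. dig n i * den i) = (\<Sum>i<k. dig n i * den i)"
    using k(1) dig_eq_0[OF assms] by (intro sum.mono_neutral_left) auto
  then show ?thesis using k(3) by simp
qed

text \<open>The number of \<open>n \<ge> h\<close> whose digits from position \<open>l\<close> on are those of \<open>h\<close>, where the digits of
  \<open>h\<close> below \<open>l\<close> vanish.\<close>

definition block_len :: "nat \<Rightarrow> nat \<Rightarrow> nat" where
  "block_len l h = (if dig h l = pq (Suc l) then den (l - 1) else den l)"

text \<open>The digits of \<open>h\<close> and \<open>y\<close> occupy disjoint positions.
  Admissibility is delicate only at the junction: a maximal digit of \<open>h\<close> at l requires
  digit l - 1 of \<open>y\<close> to vanish, which y < q_(l-1) ensures.\<close>

lemma dig_add:
  assumes l: "l \<ge> 1" and h: "\<And>i. i < l \<Longrightarrow> dig h i = 0" and y: "y < block_len l h"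
  shows "dig (h + y) = (\<lambda>i. dig h i + dig y i)"
    and "ostrowski_sum \<alpha> (h + y) = ostrowski_sum \<alpha> h + ostrowski_sum \<alpha> y"
proof -
  have yl: "y < den l" using y den_mono[of "l - 1" l] by (auto simp: block_len_def split: if_splits)
  obtain k where k: "l \<le> k" "\<And>i. i \<ge> k \<Longrightarrow> dig h i = 0" "h = (\<Sum>i<k. dig h i * den i)"
    "ostrowski_sum \<alpha> h = (\<Sum>i<k. dig h i)" by (rule obtain_digs[of l h]) blast
  obtain k' where k': "k \<le> k'" "\<And>i. i \<ge> k' \<Longrightarrow> dig y i = 0" "y = (\<Sum>i<k'. dig y i * den i)"
    "ostrowski_sum \<alpha> y = (\<Sum>i<k'. dig y i)" by (rule obtain_digs[of k y]) blast
  obtain k3 where k3: "k' \<le> k3" "\<And>i. i \<ge> k3 \<Longrightarrow> dig (h + y) i = 0"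
    "h + y = (\<Sum>i<k3. dig (h + y) i * den i)"
    "ostrowski_sum \<alpha> (h + y) = (\<Sum>i<k3. dig (h + y) i)" by (rule obtain_digs[of k' "h + y"]) blast
  have ext: "(\<Sum>i<k3. f i) = (\<Sum>i<j. f i)" if "j \<le> k3" "\<And>i. i \<ge> j \<Longrightarrow> f i = 0" for j and f :: "nat \<Rightarrow> nat"
    using that by (intro sum.mono_neutral_right) auto
  have "ostrowski_adm \<alpha> (\<lambda>i. dig h i + dig y i)"
    unfolding ostrowski_adm_def
  proof (intro conjI allI impI)
    show "dig h 0 + dig y 0 < pq 1" using h[of 0] l adm_dig[of y] by (simp add: ostrowski_adm_def)
  next
    fix i :: nat assume "1 \<le> i"
    then show "dig h i + dig y i \<le> pq (i + 1)"
      using h[of i] dig_eq_0[OF yl, of i] dig_le[of i h] dig_le[of i y] by (cases "i < l") auto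
  next
    fix i :: nat assume i: "1 \<le> i" "dig h i + dig y i = pq (i + 1)"
    then obtain j where j: "i = Suc j" by (cases i) auto
    show "dig h (i - 1) + dig y (i - 1) = 0"
    proof (cases "i < l")
      case True
      then show ?thesis using i h[of i] h[of j] j dig_eq_pqD[of y j] by simp
    next
      case False
      then have hi: "dig h i = pq (Suc i)" using i dig_eq_0[OF yl, of i] by simp
      then have "dig h j = 0" using j dig_eq_pqD[of h j] by simp
      moreover have "dig y j = 0"
      proof (cases "i = l")
        case True
        then have "l - 1 = j" using j by simp
        then have "y < den j" using hi y True by (simp add: block_len_def)
        then show ?thesis by (rule dig_eq_0) simp
      next
        case F: False
        with False j show ?thesis by (intro dig_eq_0[OF yl]) simp
      qed
      ultimately show ?thesis using j by simp
    qed
  qed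
  then have "ostrowski_rep \<alpha> (\<Sum>i<k3. (dig h i + dig y i) * den i) (\<lambda>i. dig h i + dig y i)"
    by (rule ostrowski_repI) (use k k' k3(1) in auto)
  also have "(\<Sum>i<k3. (dig h i + dig y i) * den i) = h + y"
    using ext[of k "\<lambda>i. dig h i * den i"] ext[of k' "\<lambda>i. dig y i * den i"] k k' k3(1)
    by (simp add: ring_distribs sum.distrib)
  finally show d: "dig (h + y) = (\<lambda>i. dig h i + dig y i)" by (rule dig_eqI)
  show "ostrowski_sum \<alpha> (h + y) = ostrowski_sum \<alpha> h + ostrowski_sum \<alpha> y"
    using ext[of k "dig h"] ext[of k' "dig y"] k k' k3(1)
    by (simp add: k3(4) k(4) k'(4) d sum.distrib)
qed

lemma dig_mult_den:
  assumes l: "l \<ge> 1" and b: "b \<le> pq (Suc l)"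
  shows "dig (b * den l) = (\<lambda>i. if i = l then b else 0)" "ostrowski_sum \<alpha> (b * den l) = b"
proof -
  let ?f = "\<lambda>i. if i = l then b else 0"
  have "ostrowski_adm \<alpha> ?f"
    unfolding ostrowski_adm_def
  proof (intro conjI allI impI)
    fix i :: nat assume "1 \<le> i" "?f i = pq (i + 1)"
    then show "?f (i - 1) = 0" using pq_pos[of "i + 1"] by (auto split: if_splits)
  qed (use l b pq_pos[of 1] in auto)
  then have "ostrowski_rep \<alpha> (\<Sum>i<Suc l. ?f i * den i) ?f"
    by (rule ostrowski_repI) auto
  also have "(\<Sum>i<Suc l. ?f i * den i) = b * den l"
    by simp
  finally show d: "dig (b * den l) = ?f" by (rule dig_eqI)
  have "{i. ?f i \<noteq> 0} = (if b = 0 then {} else {l})" by auto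
  then show "ostrowski_sum \<alpha> (b * den l) = b" by (simp add: ostrowski_sum_def d)
qed

text \<open>Peels off the leading digit, which yields the recurrence for the exponential sums.
  Position 0 is excluded because the digit there must stay strictly below its partial
  quotient.\<close>

lemma ostrowski_sum_mult_den_add:
  assumes "l \<ge> 1" "b \<le> pq (Suc l)" "y < (if b = pq (Suc l) then den (l - 1) else den l)"
  shows "ostrowski_sum \<alpha> (b * den l + y) = b + ostrowski_sum \<alpha> y"
proof -
  have "ostrowski_sum \<alpha> (b * den l + y) = ostrowski_sum \<alpha> (b * den l) + ostrowski_sum \<alpha> y"
    by (rule dig_add(2)[OF assms(1)]) (use assms in \<open>simp_all add: dig_mult_den block_len_def\<close>)
  then show ?thesis using assms by (simp add: dig_mult_den)
qed

section \<open>Blocks of integers sharing all digits from position l on\<close>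

definition block_start :: "nat \<Rightarrow> nat \<Rightarrow> nat" where
  "block_start l n = n - (\<Sum>i<l. dig n i * den i)"

text \<open>Erasing low digits preserves admissibility. The erased part is below q_l, and below
  q_(l-1) if the digit at l is maximal, since the digit at l - 1 is then already zero.\<close>

lemma block_start:
  assumes l: "l \<ge> 1"
  shows "dig (block_start l n) = (\<lambda>i. if i < l then 0 else dig n i)"
    and "block_start l n \<le> n" and "n < block_start l n + block_len l (block_start l n)"
proof -
  let ?f = "\<lambda>i. if i < l then 0 else dig n i" and ?c = "\<lambda>i. if i < l then dig n i else 0"
  obtain k where k: "l \<le> k" "\<And>i. i \<ge> k \<Longrightarrow> dig n i = 0" "n = (\<Sum>i<k. dig n i * den i)"
    by (rule obtain_digs[of l n]) blast
  have adm: "ostrowski_adm \<alpha> ?f"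
    unfolding ostrowski_adm_def
  proof (intro conjI allI impI)
    show "?f 0 < pq 1" using l pq_pos[of 1] by simp
  next
    fix i :: nat assume "1 \<le> i"
    then show "?f i \<le> pq (i + 1)" using dig_le[of i n] by simp
  next
    fix i :: nat assume i: "1 \<le> i" "?f i = pq (i + 1)"
    then obtain j where "i = Suc j" by (cases i) auto
    then show "?f (i - 1) = 0" using i pq_pos[of "i + 1"] dig_eq_pqD[of n j] by (auto split: if_splits)
  qed
  \<comment> \<open>The truncating subtraction in \<open>block_start\<close> is therefore
    exact.\<close>
  have split: "n = (\<Sum>i<k. ?f i * den i) + (\<Sum>i<l. dig n i * den i)"
  proof -
    have "(\<Sum>i<l. dig n i * den i) = (\<Sum>i<k. ?c i * den i)"
      using k(1) by (intro sum.mono_neutral_cong_left) auto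
    then have "(\<Sum>i<k. ?f i * den i) + (\<Sum>i<l. dig n i * den i) = (\<Sum>i<k. dig n i * den i)"
      by (simp only: sum.distrib [symmetric]) (intro sum.cong refl, simp)
    then show ?thesis using k(3) by simp
  qed
  then have bs: "block_start l n = (\<Sum>i<k. ?f i * den i)"
    unfolding block_start_def by linarith
  have "ostrowski_rep \<alpha> (\<Sum>i<k. ?f i * den i) ?f" by (rule ostrowski_repI) (use adm k in auto)
  then show d: "dig (block_start l n) = ?f" unfolding bs by (rule dig_eqI)
  show "block_start l n \<le> n" by (simp add: block_start_def)
  have "(\<Sum>i<l. dig n i * den i) < block_len l (block_start l n)"
  proof (cases "dig n l = pq (Suc l)")
    case True
    obtain j where j: "l = Suc j" using l by (cases l) auto
    then have "dig n j = 0" using True dig_eq_pqD by simp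
    then show ?thesis using True j ostrowski_adm_sum_less[OF pq_pos adm_dig[of n], of j]
      by (simp add: block_len_def d[unfolded j])
  next
    case False
    then show ?thesis using ostrowski_adm_sum_less[OF pq_pos adm_dig[of n], of l]
      by (simp add: block_len_def d)
  qed
  then show "n < block_start l n + block_len l (block_start l n)"
    using split bs by linarith
qed

text \<open>Together with the bounds in \<open>block_start\<close>, this makes each fibre the
  interval from h of length \<open>block_len l h\<close>.\<close>

lemma block_start_eqI:
  assumes l: "l \<ge> 1" and h: "\<And>i. i < l \<Longrightarrow> dig h i = 0" and n: "h \<le> n" "n < h + block_len l h"
  shows "block_start l n = h"
proof -
  define y where "y = n - h"
  have y: "y < block_len l h" "n = h + y" using n by (auto simp: y_def)
  have yl: "y < den l" using y den_mono[of "l - 1" l] by (auto simp: block_len_def split: if_splits)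
  have "(\<Sum>i<l. dig n i * den i) = y"
    using h dig_less_den[OF yl] by (simp add: y(2) dig_add(1)[OF l h y(1)])
  then show ?thesis by (simp add: block_start_def y(2))
qed

lemma block_len_le: "block_len l h \<le> den l"
  using den_mono[of "l - 1" l] by (simp add: block_len_def)

text \<open>Only the block containing N - 1 can be cut off by N. It costs at most its length, hence
  q_l; all other blocks are complete.\<close>

lemma norm_sum_le_sum_blocks:
  fixes F :: "nat \<Rightarrow> complex"
  assumes l: "l \<ge> 1" and F: "\<And>n. cmod (F n) \<le> 1"
  shows "cmod (\<Sum>n<N. F n) \<le>
    real (den l) + (\<Sum>h | h < N \<and> (\<forall>i<l. dig h i = 0). cmod (\<Sum>y<block_len l h. F (h + y)))"
proof -
  define B where "B h = (\<Sum>n | n \<in> {..<N} \<and> block_start l n = h. F n)" for h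
  define H where "H = {h. h < N \<and> (\<forall>i<l. dig h i = 0)}"
  have finH: "finite H" by (simp add: H_def)
  have sub: "block_start l ` {..<N} \<subseteq> H"
    by (auto simp: H_def block_start(1)[OF l] intro: le_less_trans[OF block_start(2)[OF l]])
  have B: "cmod (B h) \<le> (if h = block_start l (N - 1) then real (den l) else 0) +
      cmod (\<Sum>y<block_len l h. F (h + y))" if h: "h \<in> H" for h
  proof -
    have eq: "{n. n \<in> {..<N} \<and> block_start l n = h} = {n. n < N \<and> h \<le> n \<and> n < h + block_len l h}"
      using block_start(2,3)[OF l] block_start_eqI[OF l, of h] h by (auto simp: H_def)
    show ?thesis
    proof (cases "h + block_len l h \<le> N")
      case True
      then have "{n. n < N \<and> h \<le> n \<and> n < h + block_len l h} = {0 + h..<block_len l h + h}" by auto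
      then have "B h = (\<Sum>n\<in>{0 + h..<block_len l h + h}. F n)" by (simp only: B_def eq)
      also have "\<dots> = (\<Sum>y<block_len l h. F (h + y))"
        by (subst sum.shift_bounds_nat_ivl) (simp add: atLeast0LessThan add.commute)
      finally show ?thesis by simp
    next
      case False
      then have last: "block_start l (N - 1) = h"
        using h by (intro block_start_eqI[OF l]) (auto simp: H_def)
      have "cmod (B h) \<le> (\<Sum>n\<in>{n. n < N \<and> h \<le> n \<and> n < h + block_len l h}. 1)"
        unfolding B_def eq by (intro sum_norm_le F)
      also have "\<dots> \<le> real (card {h..<h + block_len l h})"
        by (simp only: sum_constant mult_1_right of_nat_le_iff, intro card_mono) auto
      also have "\<dots> \<le> real (den l)" by (simp add: block_len_le)
      finally show ?thesis using last by (simp add: add_increasing2)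
    qed
  qed
  have "(\<Sum>n<N. F n) = (\<Sum>h\<in>block_start l ` {..<N}. B h)"
    unfolding B_def by (rule sum.image_gen) simp
  then have "cmod (\<Sum>n<N. F n) \<le> (\<Sum>h\<in>block_start l ` {..<N}. cmod (B h))"
    by (simp add: norm_sum)
  also have "\<dots> \<le> (\<Sum>h\<in>H. cmod (B h))" by (intro sum_mono2 finH sub) simp
  also have "\<dots> \<le> (\<Sum>h\<in>H. (if h = block_start l (N - 1) then real (den l) else 0) +
      cmod (\<Sum>y<block_len l h. F (h + y)))" by (intro sum_mono B)
  also have "\<dots> \<le> real (den l) + (\<Sum>h\<in>H. cmod (\<Sum>y<block_len l h. F (h + y)))"
    using finH by (simp add: sum.distrib)
  finally show ?thesis by (simp add: H_def)
qed

end

section \<open>The number with continued fraction 1, m, 1, m, ...\<close>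

lemma sum_lessThan_mult_add:
  fixes f :: "nat \<Rightarrow> 'a::comm_monoid_add"
  shows "(\<Sum>n<c * d + e. f n) = (\<Sum>b<c. \<Sum>y<d. f (b * d + y)) + (\<Sum>y<e. f (c * d + y))"
proof -
  have "(\<Sum>n<c * d. f n) = (\<Sum>b<c. \<Sum>y<d. f (b * d + y))"
  proof (induction c)
    case (Suc c)
    have "(\<Sum>n<Suc c * d. f n) = (\<Sum>n<c * d + d. f n)" by (simp add: add.commute)
    then show ?case by (simp add: sum_lessThan_add Suc)
  qed simp
  then show ?thesis by (simp add: sum_lessThan_add)
qed

locale ostrowski_1m =
  fixes m :: nat
  assumes m_ge_2: "m \<ge> 2"
begin

abbreviation "a \<equiv> cf_1m m"

sublocale ostrowski "cf_1m m"
  by unfold_locales (use m_ge_2 in \<open>simp add: cf_pq_cf_1m\<close>)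

lemma pq_even: "cf_pq (cf_1m m) (Suc (Suc (2 * k))) = m"
  and pq_odd: "cf_pq (cf_1m m) (Suc (2 * k)) = 1"
  using m_ge_2 by (simp_all add: cf_pq_cf_1m)

lemma den_0: "den 0 = 1" and den_1: "den (Suc 0) = 1"
  using pq_odd[of 0] by simp_all

lemma den_even: "den (Suc (Suc (2 * k))) = m * den (Suc (2 * k)) + den (2 * k)"
  unfolding cf_denom.simps(3) pq_even ..

lemma den_odd: "den (Suc (Suc (Suc (2 * k)))) = den (Suc (Suc (2 * k))) + den (Suc (2 * k))"
  unfolding cf_denom.simps(3)[of _ "Suc (2 * k)"] using pq_odd[of "Suc k"] by simp

declare cf_denom.simps(3) [simp del]

lemma a_pos: "0 < a" and a_less_1: "a < 1"
  using cf_1m_bounds[of m] m_ge_2 by simp_all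

lemma a_eq: "a * a = real m * (1 - a)"
  using cf_1m_eq[of m] by (simp add: power2_eq_square algebra_simps)

text \<open>Makes later constants independent of m: 1 / a <= 2 and 1 - a <= 1 / 2.\<close>

lemma a_ge_half: "1 / 2 \<le> a"
proof (rule ccontr)
  assume "\<not> ?thesis"
  then have "a < 1 / 2" by simp
  then have "a * a \<le> 1 / 2 * (1 / 2)" using a_pos by (intro mult_mono) auto
  moreover have "real m * (1 / 2) \<le> real m * (1 - a)" using \<open>a < 1 / 2\<close> by (intro mult_left_mono) auto
  ultimately show False using a_eq m_ge_2 by simp
qed

lemma lam_m: "(1 - a) * (real m / a + 1) = 1"
  using a_pos a_eq by (simp add: field_simps)

text \<open>The corners (a, 1) and (1, 1 / a) of the box for the rescaled pair are multiples of the
  Perron eigenvector, hence fixed by the rescaled two-step recurrence. That map is monotone, so the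
  box is invariant; it contains the initial pair (1, 1).\<close>

lemma den_bounds:
  "a \<le> (1 - a) ^ k * real (den (2 * k)) \<and> (1 - a) ^ k * real (den (2 * k)) \<le> 1 \<and>
   1 \<le> (1 - a) ^ k * real (den (Suc (2 * k))) \<and> (1 - a) ^ k * real (den (Suc (2 * k))) \<le> 1 / a"
proof (induction k)
  case 0
  then show ?case using a_pos a_less_1 den_0 den_1 by simp
next
  case (Suc k)
  define x y where "x = (1 - a) ^ k * real (den (2 * k))" and "y = (1 - a) ^ k * real (den (Suc (2 * k)))"
  have x': "(1 - a) ^ Suc k * real (den (2 * Suc k)) = (1 - a) * (real m * y + x)"
    unfolding mult_Suc_right add_2_eq_Suc den_even x_def y_def of_nat_add of_nat_mult power_Suc
    by (simp only: ring_distribs mult_ac)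
  have y': "(1 - a) ^ Suc k * real (den (Suc (2 * Suc k))) = (1 - a) * (real m * y + x) + (1 - a) * y"
    unfolding x' [symmetric] unfolding mult_Suc_right add_2_eq_Suc den_odd y_def of_nat_add power_Suc
    by (simp only: ring_distribs mult_ac)
  have IH: "a \<le> x" "x \<le> 1" "1 \<le> y" "y \<le> 1 / a" using Suc by (simp_all add: x_def y_def)
  have "(1 - a) * (real m * y + x) \<le> (1 - a) * (real m * (1 / a) + 1)"
    using IH a_less_1 by (intro mult_left_mono add_mono) auto
  then have u: "(1 - a) * (real m * y + x) \<le> 1" using lam_m by simp
  have "(1 - a) * (real m * 1 + a) \<le> (1 - a) * (real m * y + x)"
    using IH a_less_1 by (intro mult_left_mono add_mono) auto
  then have l: "a \<le> (1 - a) * (real m * y + x)" using a_eq by (simp add: algebra_simps)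
  have "(1 - a) * y \<le> (1 - a) * (1 / a)" "(1 - a) * 1 \<le> (1 - a) * y"
    using IH a_less_1 by (intro mult_left_mono; simp)+
  moreover have "(1 - a) * (1 / a) = 1 / a - 1" using a_pos by (simp add: field_simps)
  ultimately have "(1 - a) * y \<le> 1 / a - 1" "1 - a \<le> (1 - a) * y" by simp_all
  then show ?case unfolding x' y' using u l by (intro conjI; linarith)
qed

text \<open>\<open>conv_err i = q\<^sub>i \<alpha> - p\<^sub>i\<close>, the approximation error of the \<open>i\<close>-th convergent.\<close>

definition conv_err :: "nat \<Rightarrow> real" where
  "conv_err i = (if even i then a * (1 - a) ^ (i div 2) else - ((1 - a) ^ Suc (i div 2)))"

text \<open>The errors alternate in sign, so the recurrence of the denominators becomes one between
  absolute values, which telescopes.\<close>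

lemma conv_err_rec:
  "conv_err (Suc (Suc i)) = real (cf_pq a (Suc (Suc i))) * conv_err (Suc i) + conv_err i"
  "\<bar>conv_err i\<bar> = real (cf_pq a (Suc (Suc i))) * \<bar>conv_err (Suc i)\<bar> + \<bar>conv_err (Suc (Suc i))\<bar>"
proof -
  consider k where "i = 2 * k" | k where "i = Suc (2 * k)" by (metis evenE oddE Suc_eq_plus1)
  then have "conv_err (Suc (Suc i)) = real (cf_pq a (Suc (Suc i))) * conv_err (Suc i) + conv_err i \<and>
    \<bar>conv_err i\<bar> = real (cf_pq a (Suc (Suc i))) * \<bar>conv_err (Suc i)\<bar> + \<bar>conv_err (Suc (Suc i))\<bar>"
  proof cases
    case 1
    have pos: "a * (1 - a) ^ Suc k > 0" "(1 - a) ^ Suc k > 0" "a * (1 - a) ^ k > 0"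
      using a_pos a_less_1 by simp_all
    have ce: "conv_err i = a * (1 - a) ^ k" "conv_err (Suc i) = - ((1 - a) ^ Suc k)"
      "conv_err (Suc (Suc i)) = a * (1 - a) ^ Suc k" unfolding 1 by (simp_all add: conv_err_def)
    have "a * (1 - a) ^ Suc k = real m * - ((1 - a) ^ Suc k) + a * (1 - a) ^ k"
      using arg_cong[OF a_eq, of "\<lambda>t. t * (1 - a) ^ k"] by (simp add: algebra_simps)
    then show ?thesis using pos unfolding ce abs_minus abs_of_pos[OF pos(1)] abs_of_pos[OF pos(2)]
        abs_of_pos[OF pos(3)] unfolding 1 pq_even by linarith
  next
    case 2
    have "- ((1 - a) ^ Suc (Suc k)) = a * (1 - a) ^ Suc k - (1 - a) ^ Suc k"
      by (simp add: algebra_simps)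
    then show ?thesis using a_pos a_less_1 pq_odd[of "Suc k"] unfolding 2 by (simp add: conv_err_def abs_mult)
  qed
  then show "conv_err (Suc (Suc i)) = real (cf_pq a (Suc (Suc i))) * conv_err (Suc i) + conv_err i"
    "\<bar>conv_err i\<bar> = real (cf_pq a (Suc (Suc i))) * \<bar>conv_err (Suc i)\<bar> + \<bar>conv_err (Suc (Suc i))\<bar>"
    by auto
qed

text \<open>Expresses the numerators p_i through integrality alone.\<close>

lemma den_conv_err_Ints: "real (den i) * a - conv_err i \<in> \<int>"
proof (induction i rule: induct_nat_012)
  case 0
  then show ?case using den_0 by (simp add: conv_err_def)
next
  case 1
  then show ?case using den_1 by (simp add: conv_err_def)
next
  case (ge2 i)
  have "real (den (Suc (Suc i))) * a - conv_err (Suc (Suc i)) =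
    real (cf_pq a (Suc (Suc i))) * (real (den (Suc i)) * a - conv_err (Suc i)) + (real (den i) * a - conv_err i)"
    by (simp add: conv_err_rec(1) cf_denom.simps(3) algebra_simps)
  also have "\<dots> \<in> \<int>" by (intro Ints_add Ints_mult ge2 Ints_of_nat)
  finally show ?case .
qed

text \<open>Each term is |conv_err (p + i)| - |conv_err (p + i + 2)|, so the sum telescopes with lag
  two.\<close>

lemma sum_conv_err:
  "(\<Sum>i<n. real (cf_pq a (Suc (Suc (p + i)))) * \<bar>conv_err (Suc (p + i))\<bar>) \<le> \<bar>conv_err p\<bar> + \<bar>conv_err (Suc p)\<bar>"
proof -
  have "(\<Sum>i<n. real (cf_pq a (Suc (Suc (p + i)))) * \<bar>conv_err (Suc (p + i))\<bar>) +
      \<bar>conv_err (p + n)\<bar> + \<bar>conv_err (Suc (p + n))\<bar> = \<bar>conv_err p\<bar> + \<bar>conv_err (Suc p)\<bar>"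
  proof (induction n)
    case (Suc n)
    then show ?case using conv_err_rec(2)[of "p + n"] by simp
  qed simp
  then show ?thesis by linarith
qed

text \<open>Modulo integers, h \<alpha> is the sum of the errors from position 2k + 1 on, weighted
  by the digits of h. Bounding digits by partial quotients makes it telescope.\<close>

lemma near_int_of_dig_eq_0:
  assumes "\<And>i. i < Suc (2 * k) \<Longrightarrow> dig h i = 0"
  shows "\<exists>z::int. \<bar>real h * a - of_int z\<bar> \<le> (1 - a) ^ k"
proof -
  obtain k' where k': "Suc (2 * k) \<le> k'" "\<And>i. i \<ge> k' \<Longrightarrow> dig h i = 0" "h = (\<Sum>i<k'. dig h i * den i)"
    "ostrowski_sum a h = (\<Sum>i<k'. dig h i)" by (rule obtain_digs[of "Suc (2 * k)" h]) blast
  obtain n where n: "k' = Suc (2 * k) + n" using k'(1) by (rule le_Suc_ex[THEN exE])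
  define E where "E = (\<Sum>i<k'. real (dig h i) * conv_err i)"
  have "real h * a = (\<Sum>i<k'. real (dig h i) * real (den i) * a)"
    by (subst k'(3)) (simp add: sum_distrib_right)
  then have "real h * a - E = (\<Sum>i<k'. real (dig h i) * (real (den i) * a - conv_err i))"
    by (simp add: E_def sum_subtractf algebra_simps)
  also have "\<dots> \<in> \<int>" by (intro Ints_sum Ints_mult den_conv_err_Ints Ints_of_nat)
  finally obtain z where z: "real h * a - E = of_int z" by (elim Ints_cases)
  have "\<bar>E\<bar> \<le> (\<Sum>i<k'. \<bar>real (dig h i) * conv_err i\<bar>)" unfolding E_def by (rule sum_abs)
  also have "\<dots> = (\<Sum>i<n. real (dig h (Suc (2 * k) + i)) * \<bar>conv_err (Suc (2 * k) + i)\<bar>)"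
    unfolding n sum_lessThan_add using assms by (simp add: abs_mult)
  also have "\<dots> \<le> (\<Sum>i<n. real (cf_pq a (Suc (Suc (2 * k + i)))) * \<bar>conv_err (Suc (2 * k + i))\<bar>)"
    using dig_le by (intro sum_mono mult_mono) auto
  also have "\<dots> \<le> \<bar>conv_err (2 * k)\<bar> + \<bar>conv_err (Suc (2 * k))\<bar>" by (rule sum_conv_err)
  also have "\<dots> = (1 - a) ^ k" using a_pos a_less_1 by (simp add: conv_err_def abs_mult algebra_simps)
  finally show ?thesis using z by (intro exI[of _ z]) linarith
qed

text \<open>The norm \<open>(p - n \<alpha>) (p - n \<alpha>')\<close>, with \<open>\<alpha>' = - m - \<alpha>\<close> the conjugate of \<open>\<alpha>\<close>, is a nonzero integer,
  because the discriminant \<open>m\<^sup>2 + 4 m\<close> lies strictly between \<open>(m + 1)\<^sup>2\<close> and \<open>(m + 2)\<^sup>2\<close>.\<close>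

lemma badly_approximable:
  assumes n: "n > 0"
  shows "1 \<le> (real m + 3) * real n * \<bar>real n * a - of_int p\<bar>"
proof -
  define I where "I = p\<^sup>2 + int m * p * int n - int m * (int n)\<^sup>2"
  have "I \<noteq> 0"
  proof
    assume "I = 0"
    \<comment> \<open>Completing the square: 4 I = u^2 - n^2 (m^2 + 4 m).\<close>
    define u where "u = 2 * p + int m * int n"
    have u2: "u\<^sup>2 = (int n)\<^sup>2 * (int m * int m + 4 * int m)"
      using \<open>I = 0\<close> unfolding I_def u_def by (simp add: power2_eq_square algebra_simps)
    then have "(int n)\<^sup>2 dvd u\<^sup>2" by simp
    then have "int n dvd u" by (simp add: pow_divides_pow_iff)
    then obtain v where "u = int n * v" by blast
    then have v: "\<bar>v\<bar> * \<bar>v\<bar> = int m * int m + 4 * int m"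
      using u2 n by (simp add: power2_eq_square)
    have "\<bar>v\<bar> \<ge> int m + 2 \<or> \<bar>v\<bar> \<le> int m + 1" by linarith
    then show False
    proof
      assume "\<bar>v\<bar> \<ge> int m + 2"
      then have "(int m + 2) * (int m + 2) \<le> \<bar>v\<bar> * \<bar>v\<bar>" by (intro mult_mono) auto
      then show False unfolding v by (simp add: algebra_simps)
    next
      assume "\<bar>v\<bar> \<le> int m + 1"
      then have "\<bar>v\<bar> * \<bar>v\<bar> \<le> (int m + 1) * (int m + 1)" by (intro mult_mono) auto
      then show False unfolding v using m_ge_2 by (simp add: algebra_simps)
    qed
  qed
  then have I1: "1 \<le> \<bar>real_of_int I\<bar>" by linarith
  define x where "x = real n * a - of_int p"
  have "real_of_int I = - x * (of_int p + real n * (real m + a))"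
  proof -
    have "- x * (of_int p + real n * (real m + a)) =
      of_int p * of_int p + real m * of_int p * real n - real n * real n * (a * (real m + a))"
      by (simp add: x_def algebra_simps)
    also have "a * (real m + a) = real m" using a_eq by (simp add: algebra_simps)
    finally show ?thesis by (simp add: I_def power2_eq_square algebra_simps)
  qed
  then have I_le: "1 \<le> \<bar>x\<bar> * \<bar>of_int p + real n * (real m + a)\<bar>" using I1 by (simp add: abs_mult)
  have "1 \<le> \<bar>x\<bar> * ((real m + 3) * real n)"
  proof (cases "\<bar>x\<bar> \<ge> 1")
    case True
    have "1 * 1 \<le> (real m + 3) * real n" using n by (intro mult_mono) auto
    then have "1 * 1 \<le> \<bar>x\<bar> * ((real m + 3) * real n)" using True by (intro mult_mono) auto
    then show ?thesis by simp
  next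
    case False
    have "of_int p + real n * (real m + a) = - x + real n * (real m + 2 * a)"
      by (simp add: x_def algebra_simps)
    moreover have "0 \<le> real n * (real m + 2 * a)" using a_pos by simp
    \<comment> \<open>For |x| < 1 the conjugate factor is close to n (m + 2 a); with n >= 1 and a <
      1 it is at most (m + 3) n.\<close>
    ultimately have "\<bar>of_int p + real n * (real m + a)\<bar> \<le> 1 + real n * (real m + 2 * a)"
      using False by linarith
    also have "\<dots> \<le> real n + real n * (real m + 2)"
      using n a_less_1 by (intro add_mono mult_left_mono) auto
    finally have "\<bar>of_int p + real n * (real m + a)\<bar> \<le> (real m + 3) * real n" by (simp add: algebra_simps)
    then show ?thesis using I_le by (meson abs_ge_zero mult_left_mono order_trans)
  qed
  then show ?thesis by (simp add: x_def mult_ac)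
qed

end

section \<open>Uniform bounds for the Ostrowski exponential sums\<close>

context ostrowski_1m begin

definition exp_sum :: "real \<Rightarrow> real \<Rightarrow> nat \<Rightarrow> complex" where
  "exp_sum \<gamma> \<beta> i = (\<Sum>n<den i. expi (\<gamma> * real (ostrowski_sum a n)) * expi (\<beta> * real n))"

text \<open>The phase gained by raising digit i by one: the digit sum grows by 1 and n by
  q_i.\<close>

definition phase :: "real \<Rightarrow> real \<Rightarrow> nat \<Rightarrow> real" where
  "phase \<gamma> \<beta> i = \<gamma> + \<beta> * real (den i)"

text \<open>Sort n < q_(i+2) by the leading digit b. Each b below the partial quotient gives a
  twisted copy of the sum of length q_(i+1); the maximal digit leaves only q_i values.\<close>

lemma exp_sum_rec:
  defines "t \<equiv> \<lambda>\<gamma> \<beta> i. phase \<gamma> \<beta> (Suc i)"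
  shows "exp_sum \<gamma> \<beta> (Suc (Suc i)) =
    (\<Sum>b<cf_pq a (Suc (Suc i)). expi (real b * t \<gamma> \<beta> i)) * exp_sum \<gamma> \<beta> (Suc i) +
    expi (real (cf_pq a (Suc (Suc i))) * t \<gamma> \<beta> i) * exp_sum \<gamma> \<beta> i"
proof -
  let ?F = "\<lambda>n. expi (\<gamma> * real (ostrowski_sum a n)) * expi (\<beta> * real n)" and ?c = "cf_pq a (Suc (Suc i))"
  have F: "?F (b * den (Suc i) + y) = expi (real b * t \<gamma> \<beta> i) * ?F y"
    if "b \<le> ?c" "y < (if b = ?c then den i else den (Suc i))" for b y
  proof -
    have "ostrowski_sum a (b * den (Suc i) + y) = b + ostrowski_sum a y"
      by (rule ostrowski_sum_mult_den_add) (use that in auto)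
    then have "?F (b * den (Suc i) + y) = expi (\<gamma> * real (b + ostrowski_sum a y) + \<beta> * real (b * den (Suc i) + y))"
      by (simp only: expi_add)
    also have "\<gamma> * real (b + ostrowski_sum a y) + \<beta> * real (b * den (Suc i) + y) =
        real b * t \<gamma> \<beta> i + (\<gamma> * real (ostrowski_sum a y) + \<beta> * real y)"
      by (simp add: t_def phase_def algebra_simps)
    finally show ?thesis by (simp only: expi_add)
  qed
  have "exp_sum \<gamma> \<beta> (Suc (Suc i)) = (\<Sum>n<?c * den (Suc i) + den i. ?F n)"
    by (simp only: exp_sum_def cf_denom.simps(3))
  also have "\<dots> = (\<Sum>b<?c. \<Sum>y<den (Suc i). ?F (b * den (Suc i) + y)) + (\<Sum>y<den i. ?F (?c * den (Suc i) + y))"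
    by (rule sum_lessThan_mult_add)
  also have "(\<Sum>b<?c. \<Sum>y<den (Suc i). ?F (b * den (Suc i) + y)) =
      (\<Sum>b<?c. \<Sum>y<den (Suc i). expi (real b * t \<gamma> \<beta> i) * ?F y)"
    by (intro sum.cong refl F) auto
  also have "\<dots> = (\<Sum>b<?c. expi (real b * t \<gamma> \<beta> i)) * exp_sum \<gamma> \<beta> (Suc i)"
    unfolding exp_sum_def sum_distrib_left [symmetric] sum_distrib_right [symmetric] ..
  also have "(\<Sum>y<den i. ?F (?c * den (Suc i) + y)) = (\<Sum>y<den i. expi (real ?c * t \<gamma> \<beta> i) * ?F y)"
    by (intro sum.cong refl F) auto
  also have "\<dots> = expi (real ?c * t \<gamma> \<beta> i) * exp_sum \<gamma> \<beta> i"
    unfolding exp_sum_def sum_distrib_left [symmetric] ..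
  finally show ?thesis .
qed

text \<open>\<open>(1, 1 / \<alpha>)\<close> is the Perron eigenvector, with eigenvalue \<open>1 / (1 - \<alpha>)\<close>, of the two-step
  recurrence of the denominators; \<open>exp_sum_norm\<close> is the associated weighted maximum norm.\<close>

definition exp_sum_norm :: "real \<Rightarrow> real \<Rightarrow> nat \<Rightarrow> real" where
  "exp_sum_norm \<gamma> \<beta> k = max (cmod (exp_sum \<gamma> \<beta> (2 * k))) (a * cmod (exp_sum \<gamma> \<beta> (Suc (2 * k))))"

lemma exp_sum_norm_nonneg: "exp_sum_norm \<gamma> \<beta> k \<ge> 0"
  by (simp add: exp_sum_norm_def le_max_iff_disj)

text \<open>For c = 0 this is the Perron growth rate 1 / (1 - a); a gain c in the geometric sum
  lowers it by the factor 1 - (1 - a) c.\<close>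

lemma exp_sum_norm_Suc_le:
  assumes c: "c \<ge> 0" and d: "cmod (\<Sum>b<m. expi (real b * phase \<gamma> \<beta> (Suc (2 * k)))) \<le> real m - c"
  shows "(1 - a) * exp_sum_norm \<gamma> \<beta> (Suc k) \<le> (1 - (1 - a) * c) * exp_sum_norm \<gamma> \<beta> k"
proof -
  define n where "n = exp_sum_norm \<gamma> \<beta> k"
  define w where "w = (1 - a) * c * n"
  have n0: "n \<ge> 0" by (simp add: n_def exp_sum_norm_nonneg)
  have g0: "cmod (exp_sum \<gamma> \<beta> (2 * k)) \<le> n" by (simp add: n_def exp_sum_norm_def)
  have "a * cmod (exp_sum \<gamma> \<beta> (Suc (2 * k))) \<le> n" by (simp add: n_def exp_sum_norm_def)
  then have g1: "cmod (exp_sum \<gamma> \<beta> (Suc (2 * k))) \<le> n / a" using a_pos by (simp add: field_simps)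
  have "cmod (exp_sum \<gamma> \<beta> (Suc (Suc (2 * k)))) \<le>
      cmod (\<Sum>b<m. expi (real b * phase \<gamma> \<beta> (Suc (2 * k)))) * cmod (exp_sum \<gamma> \<beta> (Suc (2 * k))) + cmod (exp_sum \<gamma> \<beta> (2 * k))"
    unfolding exp_sum_rec pq_even by (rule order_trans[OF norm_triangle_ineq]) (simp add: norm_mult)
  also have "\<dots> \<le> (real m - c) * (n / a) + n"
    using d g1 g0 order_trans[OF norm_ge_zero d] by (intro add_mono mult_mono) auto
  finally have g2: "cmod (exp_sum \<gamma> \<beta> (Suc (Suc (2 * k)))) \<le> (real m / a + 1) * n - c / a * n"
    by (simp add: algebra_simps diff_divide_distrib)
  have g3: "cmod (exp_sum \<gamma> \<beta> (Suc (Suc (Suc (2 * k))))) \<le>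
      cmod (exp_sum \<gamma> \<beta> (Suc (Suc (2 * k)))) + cmod (exp_sum \<gamma> \<beta> (Suc (2 * k)))"
  proof -
    have "cf_pq a (Suc (Suc (Suc (2 * k)))) = 1" using pq_odd[of "Suc k"] by simp
    then show ?thesis unfolding exp_sum_rec[of _ _ "Suc (2 * k)"]
      by (intro order_trans[OF norm_triangle_ineq]) (simp add: norm_mult)
  qed
  have a1: "1 - a \<ge> 0" using a_less_1 by simp
  have "(1 - a) * cmod (exp_sum \<gamma> \<beta> (Suc (Suc (2 * k)))) \<le> (1 - a) * ((real m / a + 1) * n - c / a * n)"
    using g2 a1 by (rule mult_left_mono)
  also have "\<dots> = ((1 - a) * (real m / a + 1)) * n - (1 - a) * c * n / a"
    by (simp add: right_diff_distrib mult.assoc)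
  finally have h2: "(1 - a) * cmod (exp_sum \<gamma> \<beta> (Suc (Suc (2 * k)))) \<le> n - w / a"
    unfolding lam_m by (simp add: w_def)
  \<comment> \<open>The even component loses even w / a. The odd one inherits this loss, but its
    weight a turns it into w, which fixes the rate.\<close>
  have "w * 1 \<le> w * (1 / a)"
    using a1 c n0 a_pos a_less_1 by (intro mult_left_mono) (auto simp: w_def)
  then have "w \<le> w / a" by simp
  with h2 have r2: "(1 - a) * cmod (exp_sum \<gamma> \<beta> (Suc (Suc (2 * k)))) \<le> n - w" by linarith
  have "(1 - a) * cmod (exp_sum \<gamma> \<beta> (Suc (Suc (Suc (2 * k))))) \<le>
      (1 - a) * (cmod (exp_sum \<gamma> \<beta> (Suc (Suc (2 * k)))) + n / a)"
    using g3 g1 by (intro mult_left_mono a1) linarith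
  also have "\<dots> = (1 - a) * cmod (exp_sum \<gamma> \<beta> (Suc (Suc (2 * k)))) + (1 - a) * (n / a)"
    by (rule distrib_left)
  also have "\<dots> \<le> n - w / a + (1 - a) * (n / a)" using h2 by (rule add_right_mono)
  finally have "a * ((1 - a) * cmod (exp_sum \<gamma> \<beta> (Suc (Suc (Suc (2 * k)))))) \<le> a * (n - w / a + (1 - a) * (n / a))"
    using a_pos by (intro mult_left_mono) auto
  also have "\<dots> = n - w" using a_pos by (simp add: field_simps)
  finally have r3: "(1 - a) * (a * cmod (exp_sum \<gamma> \<beta> (Suc (Suc (Suc (2 * k)))))) \<le> n - w"
    by (simp only: mult.left_commute)
  have "(1 - (1 - a) * c) * n = n - w" by (simp add: w_def left_diff_distrib)
  show ?thesis
    using r2 r3 unfolding n_def [symmetric] \<open>(1 - (1 - a) * c) * n = n - w\<close>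
    unfolding exp_sum_norm_def mult_Suc_right add_2_eq_Suc by (auto simp only: max_def split: if_splits)
qed

lemma norm_sum_expi_le: "cmod (\<Sum>b<c. expi (real b * x)) \<le> real c"
  using sum_norm_le[of "{..<c}" "\<lambda>b. expi (real b * x)" "\<lambda>_. 1"] by simp

text \<open>The two-step recurrence has trace m + 2 and determinant 1, so q_(2k+5) + q_(2k+1) = (m +
  2) q_(2k+3). In the same combination of phases \<beta> cancels and (m + 2 - 2) \<gamma>
  remains.\<close>

lemma phase_combination:
  "real m * \<gamma> = real (m + 2) * phase \<gamma> \<beta> (Suc (2 * Suc k)) +
     (- phase \<gamma> \<beta> (Suc (2 * Suc (Suc k))) + - phase \<gamma> \<beta> (Suc (2 * k)))"
proof -
  have "real (den (Suc (2 * Suc k))) = real (den (Suc (Suc (2 * k)))) + real (den (Suc (2 * k)))"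
    using den_odd[of k] by (simp only: mult_Suc_right add_2_eq_Suc of_nat_add)
  moreover have "real (den (Suc (2 * Suc (Suc k)))) =
      real m * real (den (Suc (2 * Suc k))) + real (den (2 * Suc k)) + real (den (Suc (2 * Suc k)))"
    using den_odd[of "Suc k"] den_even[of "Suc k"]
    by (simp only: mult_Suc_right add_2_eq_Suc of_nat_add of_nat_mult)
  ultimately have "real (den (Suc (2 * Suc (Suc k)))) + real (den (Suc (2 * k))) =
      real (m + 2) * real (den (Suc (2 * Suc k)))"
    by (simp add: algebra_simps)
  then have "\<beta> * real (den (Suc (2 * Suc (Suc k)))) + \<beta> * real (den (Suc (2 * k))) =
      real (m + 2) * (\<beta> * real (den (Suc (2 * Suc k))))"
    by (metis distrib_left mult.left_commute)
  then show ?thesis unfolding phase_def by (simp add: algebra_simps)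
qed

text \<open>Any three consecutive steps save at least once. The rate depends on \<gamma> but not on
  \<beta>, so it applies to all frequencies in Parseval at once.\<close>

lemma exp_sum_norm_decay:
  assumes "real m * \<gamma> \<notin> \<int>"
  obtains \<rho> where "1 / 2 \<le> \<rho>" "\<rho> < 1"
    "\<And>\<beta> j. (1 - a) ^ (3 * j) * exp_sum_norm \<gamma> \<beta> (3 * j) \<le> \<rho> ^ j"
proof -
  \<comment> \<open>m + 4 = (m + 2) + 1 + 1 is the total weight in \<open>phase_combination\<close>:
    three chords all below \<open>\<epsilon>\<close> would contradict it.\<close>
  define \<epsilon> where "\<epsilon> = cmod (expi (real m * \<gamma>) - 1) / real (m + 4)"
  define c where "c = \<epsilon>\<^sup>2 / 4"
  define \<rho> where "\<rho> = 1 - (1 - a) * c"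
  have \<epsilon>: "\<epsilon> > 0" using assms by (simp add: \<epsilon>_def expi_eq_1_iff)
  have "cmod (expi (real m * \<gamma>) - 1) \<le> 2" using norm_triangle_ineq4[of "expi (real m * \<gamma>)" 1] by simp
  then have "\<epsilon> \<le> 1" by (simp add: \<epsilon>_def)
  then have "\<epsilon>\<^sup>2 \<le> 1" using \<epsilon> by (simp add: power_le_one)
  then have c: "c > 0" "c \<le> 1 / 4" using \<epsilon> by (simp_all add: c_def)
  have a1: "0 < 1 - a" "1 - a \<le> 1 / 2" using a_less_1 a_ge_half by simp_all
  have "(1 - a) * c \<le> 1 / 2 * 1" using a1 c by (intro mult_mono) auto
  then have \<rho>: "1 / 2 \<le> \<rho>" "\<rho> < 1" using a1 c by (simp_all add: \<rho>_def)
  have step0: "(1 - a) * exp_sum_norm \<gamma> \<beta> (Suc k) \<le> exp_sum_norm \<gamma> \<beta> k" for \<beta> k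
    using exp_sum_norm_Suc_le[of 0 \<gamma> \<beta> k] norm_sum_expi_le by simp
  have step1: "(1 - a) * exp_sum_norm \<gamma> \<beta> (Suc k) \<le> \<rho> * exp_sum_norm \<gamma> \<beta> k"
    if "\<epsilon> \<le> cmod (expi (phase \<gamma> \<beta> (Suc (2 * k))) - 1)" for \<beta> k
    unfolding \<rho>_def using norm_geometric_expi_le[OF m_ge_2 _ that] \<epsilon> c
    by (intro exp_sum_norm_Suc_le) (auto simp: c_def)
  have some: "\<exists>i\<in>{k, Suc k, Suc (Suc k)}. \<epsilon> \<le> cmod (expi (phase \<gamma> \<beta> (Suc (2 * i))) - 1)" for \<beta> k
  proof (rule ccontr)
    define E where "E i = cmod (expi (phase \<gamma> \<beta> (Suc (2 * i))) - 1)" for i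
    assume "\<not> ?thesis"
    then have lt: "E k < \<epsilon>" "E (Suc k) < \<epsilon>" "E (Suc (Suc k)) < \<epsilon>" by (auto simp: E_def)
    have "cmod (expi (real m * \<gamma>) - 1) \<le> real (m + 2) * E (Suc k) + (E (Suc (Suc k)) + E k)"
      unfolding phase_combination[of \<gamma> \<beta> k] E_def
      by (intro order_trans[OF norm_expi_add_minus_1_le] add_mono norm_expi_mult_minus_1_le)
        (simp_all only: norm_expi_uminus_minus_1 order_refl)
    also have "\<dots> < real (m + 2) * \<epsilon> + (\<epsilon> + \<epsilon>)"
      using lt by (intro add_strict_mono mult_strict_left_mono) auto
    also have "\<dots> = real (m + 4) * \<epsilon>" by (simp add: algebra_simps)
    also have "\<dots> = cmod (expi (real m * \<gamma>) - 1)" by (simp add: \<epsilon>_def)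
    finally show False by simp
  qed
  have step3: "(1 - a) ^ 3 * exp_sum_norm \<gamma> \<beta> (k + 3) \<le> \<rho> * exp_sum_norm \<gamma> \<beta> k" for \<beta> k
  proof -
    define r where "r i = (if \<epsilon> \<le> cmod (expi (phase \<gamma> \<beta> (Suc (2 * i))) - 1) then \<rho> else 1)" for i
    have r: "0 \<le> r i" "r i \<le> 1" for i using \<rho> by (auto simp: r_def)
    have st: "(1 - a) * exp_sum_norm \<gamma> \<beta> (Suc i) \<le> r i * exp_sum_norm \<gamma> \<beta> i" for i
      using step0[of \<beta> i] step1[of \<beta> i] by (auto simp: r_def)
    \<comment> \<open>At least one factor is \<open>\<rho>\<close>, and the others are at most
      1.\<close>
    have "r (Suc (Suc k)) * r (Suc k) * r k \<le> \<rho>"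
    proof -
      obtain i where i: "i \<in> {k, Suc k, Suc (Suc k)}" "\<epsilon> \<le> cmod (expi (phase \<gamma> \<beta> (Suc (2 * i))) - 1)"
        using some by blast
      then have "r i = \<rho>" by (simp only: r_def if_True)
      moreover have "r x * r y \<le> 1" for x y using r by (simp add: mult_le_one)
      ultimately show ?thesis
        using i(1) mult_left_mono[of "r (Suc (Suc k)) * r (Suc k)" 1 "r k"]
          mult_left_mono[of "r (Suc (Suc k)) * r k" 1 "r (Suc k)"]
          mult_left_mono[of "r (Suc k) * r k" 1 "r (Suc (Suc k))"] r
        by (auto simp: mult_ac)
    qed
    moreover have "(1 - a) ^ 3 * exp_sum_norm \<gamma> \<beta> (k + 3) \<le> r (Suc (Suc k)) * r (Suc k) * r k * exp_sum_norm \<gamma> \<beta> k"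
    proof -
      have "(1 - a) ^ 3 * exp_sum_norm \<gamma> \<beta> (k + 3) = (1 - a) * ((1 - a) * ((1 - a) * exp_sum_norm \<gamma> \<beta> (Suc (Suc (Suc k)))))"
        by (simp add: eval_nat_numeral)
      also have "\<dots> \<le> (1 - a) * ((1 - a) * (r (Suc (Suc k)) * exp_sum_norm \<gamma> \<beta> (Suc (Suc k))))"
        using st[of "Suc (Suc k)"] a1 by (intro mult_left_mono) auto
      also have "\<dots> = r (Suc (Suc k)) * ((1 - a) * ((1 - a) * exp_sum_norm \<gamma> \<beta> (Suc (Suc k))))"
        by (simp only: mult_ac)
      also have "\<dots> \<le> r (Suc (Suc k)) * ((1 - a) * (r (Suc k) * exp_sum_norm \<gamma> \<beta> (Suc k)))"
        using st[of "Suc k"] a1 r by (intro mult_left_mono) auto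
      also have "\<dots> = r (Suc (Suc k)) * (r (Suc k) * ((1 - a) * exp_sum_norm \<gamma> \<beta> (Suc k)))"
        by (simp only: mult_ac)
      also have "\<dots> \<le> r (Suc (Suc k)) * (r (Suc k) * (r k * exp_sum_norm \<gamma> \<beta> k))"
        using st[of k] r by (intro mult_left_mono) auto
      finally show ?thesis by (simp only: mult_ac)
    qed
    ultimately show ?thesis
      using mult_right_mono[OF _ exp_sum_norm_nonneg[of \<gamma> \<beta> k]] order_trans by blast
  qed
  show thesis
  proof (rule that[OF \<rho>])
    fix \<beta> j
    show "(1 - a) ^ (3 * j) * exp_sum_norm \<gamma> \<beta> (3 * j) \<le> \<rho> ^ j"
    proof (induction j)
      case 0
      have "ostrowski_sum a 0 = 0" using ostrowski_sum_mult_den_add[of 1 0 0] dig_mult_den(2)[of 1 0] by simp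
      then show ?case using a_less_1 den_0 den_1 by (simp add: exp_sum_norm_def exp_sum_def)
    next
      case (Suc j)
      have "(1 - a) ^ (3 * Suc j) * exp_sum_norm \<gamma> \<beta> (3 * Suc j) =
          (1 - a) ^ (3 * j) * ((1 - a) ^ 3 * exp_sum_norm \<gamma> \<beta> (3 * j + 3))"
        by (simp add: power_add add.commute mult_ac)
      also have "\<dots> \<le> (1 - a) ^ (3 * j) * (\<rho> * exp_sum_norm \<gamma> \<beta> (3 * j))"
        using step3[of \<beta> "3 * j"] a1 by (intro mult_left_mono) auto
      also have "\<dots> = \<rho> * ((1 - a) ^ (3 * j) * exp_sum_norm \<gamma> \<beta> (3 * j))" by (simp only: mult_ac)
      also have "\<dots> \<le> \<rho> * \<rho> ^ j" using Suc \<rho> by (intro mult_left_mono) auto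
      finally show ?case by simp
    qed
  qed
qed

text \<open>Passes from the Perron norm to a fraction of q_(2k+1), which is at least (1 - a)^(-k);
  the factor 2 bounds 1 / a.\<close>

lemma norm_exp_sum_le:
  assumes "(1 - a) ^ k * exp_sum_norm \<gamma> \<beta> k \<le> r" and i: "i \<in> {2 * k, Suc (2 * k)}"
  shows "cmod (exp_sum \<gamma> \<beta> i) \<le> 2 * r * real (den (Suc (2 * k)))"
proof -
  define L where "L = real (den (Suc (2 * k)))"
  have p: "(1 - a) ^ k > 0" using a_less_1 by simp
  have r0: "r \<ge> 0" using order_trans[OF _ assms(1)] p exp_sum_norm_nonneg[of \<gamma> \<beta> k] by simp
  have "(1 - a) ^ k * exp_sum_norm \<gamma> \<beta> k \<le> r * ((1 - a) ^ k * L)"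
    using mult_left_mono[OF _ r0, of 1 "(1 - a) ^ k * L"] den_bounds[of k] assms(1) by (simp add: L_def)
  then have "(1 - a) ^ k * exp_sum_norm \<gamma> \<beta> k \<le> (1 - a) ^ k * (r * L)" by (simp only: mult_ac)
  then have n: "exp_sum_norm \<gamma> \<beta> k \<le> r * L" using p by (simp only: mult_le_cancel_left_pos)
  have "1 / 2 * cmod (exp_sum \<gamma> \<beta> (Suc (2 * k))) \<le> a * cmod (exp_sum \<gamma> \<beta> (Suc (2 * k)))"
    using a_ge_half by (intro mult_right_mono) auto
  moreover have "r * L \<ge> 0" using r0 by (simp add: L_def)
  moreover have "cmod (exp_sum \<gamma> \<beta> (2 * k)) \<le> exp_sum_norm \<gamma> \<beta> k" "a * cmod (exp_sum \<gamma> \<beta> (Suc (2 * k))) \<le> exp_sum_norm \<gamma> \<beta> k"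
    by (simp_all add: exp_sum_norm_def)
  ultimately have "cmod (exp_sum \<gamma> \<beta> i) \<le> 2 * (r * L)" using i n by auto
  then show ?thesis by (simp add: L_def)
qed

end

section \<open>The joint sum\<close>

text \<open>With \<sigma>^2 = \<rho>, one factor \<sigma>^j pays for N powr \<delta> and the other
  absorbs A once j >= J. For N up to \<open>X\<close> the trivial bound suffices.\<close>

lemma power_saving_of_geometric_saving:
  fixes S :: "nat \<Rightarrow> real" and A B K \<rho> :: real
  assumes A: "A > 0" and B: "B > 1" and K: "K \<ge> 1" and \<rho>: "0 < \<rho>" "\<rho> < 1"
    and saving: "\<And>j N. K * B ^ j \<le> real N \<Longrightarrow> S N \<le> A * real N * \<rho> ^ j"
    and trivial: "\<And>N. S N \<le> real N"
  shows "\<exists>\<delta>>0. \<forall>N\<ge>1. S N \<le> 2 * real N powr (1 - \<delta>)"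
proof -
  define \<sigma> where "\<sigma> = sqrt \<rho>"
  have \<sigma>: "0 < \<sigma>" "\<sigma> < 1" "\<sigma> * \<sigma> = \<rho>" using \<rho> by (simp_all add: \<sigma>_def)
  obtain J where J: "\<sigma> ^ J < 1 / A"
    using real_arch_pow_inv[of "1 / A" \<sigma>] A \<sigma> by auto
  define X where "X = K * B ^ Suc J"
  have B1: "1 \<le> B ^ i" for i using B by (simp add: one_le_power)
  have "1 * 1 < K * B ^ Suc J" using K B one_less_power[of B "Suc J"] by (intro mult_le_less_imp_less) auto
  then have X: "X > 1" by (simp add: X_def)
  \<comment> \<open>The first entry ensures \<open>X powr \<delta> \<le> 2\<close>, the second
    \<open>B powr \<delta> \<le> 1 / \<sigma>\<close>.\<close>
  define \<delta> where "\<delta> = min (ln 2 / ln X) (- ln \<sigma> / ln B)"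
  have \<delta>: "\<delta> > 0" using X B \<sigma> by (simp add: \<delta>_def divide_neg_pos)
  have "\<delta> * ln X \<le> ln 2" using X by (simp add: \<delta>_def min_def field_simps)
  then have X2: "X powr \<delta> \<le> 2" using X by (simp add: powr_def flip: ln_ge_iff)
  have "\<delta> * ln B \<le> - ln \<sigma>" using B by (simp add: \<delta>_def min_def field_simps)
  then have "B powr \<delta> \<le> exp (- ln \<sigma>)" using B by (simp add: powr_def)
  then have B2: "B powr \<delta> \<le> 1 / \<sigma>" using \<sigma> by (simp add: exp_minus field_simps)
  have "S N \<le> 2 * real N powr (1 - \<delta>)" if N: "N \<ge> 1" for N
  proof -
    have "S N * real N powr \<delta> \<le> 2 * real N"
    proof (cases "real N \<le> X")
      case True
      then have "real N powr \<delta> \<le> 2" using X2 \<delta> by (intro order_trans[OF powr_mono2 X2]) auto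
      then have "S N * real N powr \<delta> \<le> real N * 2"
        using trivial[of N] by (intro mult_mono) auto
      then show ?thesis by simp
    next
      case False
      obtain i0 where "real N < B ^ i0" using real_arch_pow[OF B] by blast
      also have "\<dots> \<le> K * B ^ i0" using mult_right_mono[OF K, of "B ^ i0"] B1[of i0] by simp
      finally have ex: "\<exists>i. real N < K * B ^ i" by blast
      define i where "i = (LEAST i. real N < K * B ^ i)"
      have i: "real N < K * B ^ i" unfolding i_def using ex by (rule LeastI_ex)
      have "Suc J < i"
      proof (rule ccontr)
        assume "\<not> Suc J < i"
        then have "K * B ^ i \<le> X" unfolding X_def using K B by (intro mult_left_mono power_increasing) auto
        then show False using i False by linarith
      qed
      then obtain j where j: "i = Suc j" "J \<le> j" by (cases i) auto
      then have "\<not> real N < K * B ^ j" 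
        using not_less_Least[of j "\<lambda>i. real N < K * B ^ i"] by (simp add: i_def)
      then have "S N \<le> A * real N * \<rho> ^ j" using saving by simp
      moreover have "real N powr \<delta> \<le> 2 * (1 / \<sigma>) ^ j"
      proof -
        have "K * B ^ i \<le> X * B ^ j"
          unfolding X_def j(1) using mult_left_mono[OF B1[of J], of "K * B * B ^ j"] K B by (simp add: mult_ac)
        then have "real N powr \<delta> \<le> (X * B ^ j) powr \<delta>" using i \<delta> by (intro powr_mono2) auto
        also have "\<dots> = X powr \<delta> * (B powr \<delta>) ^ j"
          using X B by (simp add: powr_mult powr_powr powr_realpow [symmetric] mult.commute)
        also have "\<dots> \<le> 2 * (1 / \<sigma>) ^ j" using X2 B2 by (intro mult_mono power_mono) auto
        finally show ?thesis .
      qed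
      ultimately have "S N * real N powr \<delta> \<le> (A * real N * \<rho> ^ j) * (2 * (1 / \<sigma>) ^ j)"
        using A \<rho> by (intro mult_mono) auto
      also have "\<dots> = 2 * real N * (A * \<sigma> ^ j)"
        using \<sigma>(1) unfolding \<sigma>(3) [symmetric] by (simp add: power_mult_distrib power_one_over field_simps)
      also have "A * \<sigma> ^ j \<le> 1"
      proof -
        have "\<sigma> ^ j \<le> \<sigma> ^ J" using j(2) \<sigma> by (intro power_decreasing) auto
        then have "\<sigma> ^ j \<le> 1 / A" using J by linarith
        then show ?thesis using A by (simp add: field_simps)
      qed
      finally show ?thesis by (simp add: mult_left_mono)
    qed
    then show ?thesis using N by (simp add: powr_diff field_simps)
  qed
  then show ?thesis using \<delta> by blast
qed

text \<open>The modulus must be a power of q for the digits to split; reaching one costs at most a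
  factor q.\<close>

lemma ex_power_bracket:
  fixes q L :: nat
  assumes "q \<ge> 2" "L > 0"
  obtains \<kappa> where "L \<le> q ^ \<kappa>" "q ^ \<kappa> \<le> q * L"
proof -
  have "L < q ^ L" using assms by (intro less_exp[THEN less_le_trans] power_mono) auto
  then have ex: "\<exists>i. L \<le> q ^ i" by (intro exI[of _ L]) simp
  define i where "i = (LEAST i. L \<le> q ^ i)"
  have i: "L \<le> q ^ i" unfolding i_def using ex by (rule LeastI_ex)
  have "q ^ i \<le> q * L"
  proof (cases i)
    case 0
    have "1 * 1 \<le> q * L" using assms by (intro mult_mono) auto
    then show ?thesis using 0 by simp
  next
    case (Suc i')
    then have "q ^ i' \<le> L" using not_less_Least[of i' "\<lambda>i. L \<le> q ^ i"] by (simp add: i_def)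
    then show ?thesis using Suc by simp
  qed
  with i show thesis by (rule that)
qed

section \<open>From single blocks to the joint sum\<close>

context ostrowski_1m begin

text \<open>Without a carry at position \<kappa> a unimodular factor depending only on h comes out.
  A carry needs h mod Q > Q - L, and such blocks are bounded trivially. Reducing modulo Q inside f
  gives the cyclic form of \<open>sum_norm_convolution_le\<close>.\<close>

lemma norm_block_sum_le:
  fixes q \<kappa> k h :: nat and \<theta> \<gamma> :: real
  defines "Q \<equiv> q ^ \<kappa>" and "L \<equiv> den (Suc (2 * k))"
    and "f \<equiv> \<lambda>n. expi (\<theta> * real (digit_sum q n))" and "g \<equiv> \<lambda>n. expi (\<gamma> * real (ostrowski_sum a n))"
  assumes q: "q \<ge> 2" and h: "\<And>i. i < Suc (2 * k) \<Longrightarrow> dig h i = 0"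
  defines "D \<equiv> block_len (Suc (2 * k)) h"
  shows "cmod (\<Sum>y<D. f (h + y) * g (h + y)) \<le>
    cmod (\<Sum>y<D. f ((h mod Q + y) mod Q) * g y) + (if Q < h mod Q + L then real L else 0)"
proof (cases "Q < h mod Q + L")
  case True
  have "cmod (\<Sum>y<D. f (h + y) * g (h + y)) \<le> (\<Sum>y<D. 1)"
    by (intro sum_norm_le) (simp add: f_def g_def norm_mult)
  also have "\<dots> \<le> real L" using block_len_le[of "Suc (2 * k)" h] by (simp add: D_def L_def)
  finally show ?thesis using True by (simp add: add_increasing)
next
  case False
  have DL: "D \<le> L" unfolding D_def L_def by (rule block_len_le)
  have "f (h + y) * g (h + y) =
      expi (\<theta> * real (digit_sum q (h div Q))) * g h * (f ((h mod Q + y) mod Q) * g y)" if y: "y < D" for y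
  proof -
    have lt: "h mod Q + y < Q" using False y DL by linarith
    have "h + y = h div Q * q ^ \<kappa> + (h mod Q + y)"
      unfolding Q_def by (simp only: add.assoc [symmetric] div_mult_mod_eq)
    then have "digit_sum q (h + y) = digit_sum q (h div Q * q ^ \<kappa> + (h mod Q + y))" by (rule arg_cong)
    also have "\<dots> = digit_sum q (h div Q) + digit_sum q (h mod Q + y)"
      by (rule digit_sum_add[OF q]) (use lt in \<open>simp add: Q_def\<close>)
    finally have "f (h + y) = expi (\<theta> * real (digit_sum q (h div Q))) * f ((h mod Q + y) mod Q)"
      using lt by (simp add: f_def expi_add [symmetric] ring_distribs)
    moreover have "ostrowski_sum a (h + y) = ostrowski_sum a h + ostrowski_sum a y"
      by (rule dig_add(2)[of "Suc (2 * k)"]) (use h y in \<open>auto simp: D_def\<close>)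
    then have "g (h + y) = g h * g y" by (simp add: g_def expi_add [symmetric] ring_distribs)
    ultimately show ?thesis by (simp only: mult_ac)
  qed
  then have "(\<Sum>y<D. f (h + y) * g (h + y)) =
      expi (\<theta> * real (digit_sum q (h div Q))) * g h * (\<Sum>y<D. f ((h mod Q + y) mod Q) * g y)"
    unfolding sum_distrib_left by (intro sum.cong) auto
  then show ?thesis using False by (simp add: norm_mult g_def)
qed

lemma card_block_starts_le:
  assumes Q: "Q > 0" and N: "Q * ((m + 3) * Q * den (Suc (2 * k))) \<le> N"
  shows "real (card {h. h < N \<and> (\<forall>i<Suc (2 * k). dig h i = 0) \<and> h mod Q = x}) \<le>
    14 * real N / (real Q * real (den (Suc (2 * k))))"
proof (rule card_residue_class_near_le[where \<kappa> = "real m + 3" and a = a])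
  show "1 \<le> real (den (Suc (2 * k)))" by (simp add: Suc_le_eq)
  show "1 \<le> (real m + 3) * real n * \<bar>real n * a - of_int p\<bar>" if "n > 0" for n and p :: int
    using that by (rule badly_approximable)
  show "(real m + 3) * real Q * real (den (Suc (2 * k))) \<le> real ((m + 3) * Q * den (Suc (2 * k)))" by simp
  fix h assume h: "h \<in> {h. h < N \<and> (\<forall>i<Suc (2 * k). dig h i = 0) \<and> h mod Q = x}"
  have "(1 - a) ^ k \<le> 2 / real (den (Suc (2 * k)))"
  proof -
    have "1 / a \<le> 2" using a_ge_half a_pos by (simp add: field_simps)
    then have "(1 - a) ^ k * real (den (Suc (2 * k))) \<le> 2" using den_bounds[of k] by linarith
    then show ?thesis by (simp add: pos_le_divide_eq)
  qed
  then show "h < N \<and> h mod Q = x \<and> (\<exists>z::int. \<bar>real h * a - of_int z\<bar> \<le> 2 / real (den (Suc (2 * k))))"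
    using h near_int_of_dig_eq_0[of k h] by (auto intro: order_trans)
qed (use Q N in auto)

text \<open>The term 4 r collects 2 r for each of the two possible block lengths; L / Q comes from
  the carries.\<close>

lemma norm_joint_sum_le:
  fixes q \<kappa> k N :: nat and \<theta> \<gamma> r :: real
  defines "Q \<equiv> q ^ \<kappa>" and "L \<equiv> den (Suc (2 * k))"
  assumes q: "q \<ge> 2" and N: "Q * ((m + 3) * Q * L) \<le> N"
    and r: "\<And>\<beta>. (1 - a) ^ k * exp_sum_norm \<gamma> \<beta> k \<le> r"
  shows "cmod (\<Sum>n<N. expi (\<theta> * real (digit_sum q n) + \<gamma> * real (ostrowski_sum a n))) \<le>
    real L + 14 * real N * (4 * r + real L / real Q)"
proof -
  define f where "f n = expi (\<theta> * real (digit_sum q n))" for n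
  define g where "g n = expi (\<gamma> * real (ostrowski_sum a n))" for n
  define H where "H = {h. h < N \<and> (\<forall>i<Suc (2 * k). dig h i = 0)}"
  define V where "V D x = cmod (\<Sum>y<D. f ((x + y) mod Q) * g y)" for D x
  define E where "E x = (if Q < x + L then real L else 0)" for x
  \<comment> \<open>Including both block lengths makes the bound a function of the residue of h
    alone.\<close>
  define U where "U x = V (den (2 * k)) x + V L x + E x" for x
  have Q0: "Q > 0" using q by (simp add: Q_def)
  have L0: "L > 0" by (simp add: L_def)
  have finH: "finite H" by (simp add: H_def)
  have U0: "U x \<ge> 0" for x by (simp add: U_def V_def E_def)
  have V: "(\<Sum>x<Q. V (den i) x) \<le> real Q * (2 * r * real L)" if i: "i \<in> {2 * k, Suc (2 * k)}" for i
    unfolding V_def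
  proof (rule sum_norm_convolution_le[OF Q0])
    show "cmod (\<Sum>y<den i. g y * expi (\<beta> * real y)) \<le> 2 * r * real L" for \<beta>
      using norm_exp_sum_le[OF r i] by (simp add: exp_sum_def g_def L_def)
  qed (simp add: f_def)
  \<comment> \<open>At most L residues allow a carry, each costing L.\<close>
  have "(\<Sum>x<Q. E x) = (\<Sum>x | x < Q \<and> Q < x + L. real L)"
    unfolding E_def by (intro sum.mono_neutral_cong_right) auto
  also have "\<dots> = real (card {x. x < Q \<and> Q < x + L}) * real L" by simp
  also have "\<dots> \<le> real L * real L"
  proof (rule mult_right_mono)
    have "card {x. x < Q \<and> Q < x + L} \<le> card {Q - L..<Q}" by (intro card_mono) auto
    then show "real (card {x. x < Q \<and> Q < x + L}) \<le> real L" by simp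
  qed simp
  finally have E: "(\<Sum>x<Q. E x) \<le> real L * real L" .
  have "(\<Sum>x<Q. U x) = (\<Sum>x<Q. V (den (2 * k)) x) + (\<Sum>x<Q. V L x) + (\<Sum>x<Q. E x)"
    by (simp add: U_def sum.distrib)
  also have "\<dots> \<le> real Q * (2 * r * real L) + real Q * (2 * r * real L) + real L * real L"
    using V[of "2 * k"] V[of "Suc (2 * k)"] E by (intro add_mono) (auto simp: L_def)
  also have "\<dots> = real Q * real L * (4 * r + real L / real Q)"
    using Q0 by (simp add: algebra_simps)
  finally have sumU: "(\<Sum>x<Q. U x) \<le> real Q * real L * (4 * r + real L / real Q)" .
  have "cmod (\<Sum>n<N. expi (\<theta> * real (digit_sum q n) + \<gamma> * real (ostrowski_sum a n))) =
      cmod (\<Sum>n<N. f n * g n)"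
    by (simp add: f_def g_def expi_add)
  also have "\<dots> \<le> real L + (\<Sum>h\<in>H. cmod (\<Sum>y<block_len (Suc (2 * k)) h. f (h + y) * g (h + y)))"
    unfolding H_def L_def by (rule norm_sum_le_sum_blocks) (simp_all add: f_def g_def norm_mult)
  also have "(\<Sum>h\<in>H. cmod (\<Sum>y<block_len (Suc (2 * k)) h. f (h + y) * g (h + y))) \<le> (\<Sum>h\<in>H. U (h mod Q))"
  proof (rule sum_mono)
    fix h assume "h \<in> H"
    then have "cmod (\<Sum>y<block_len (Suc (2 * k)) h. f (h + y) * g (h + y)) \<le>
        V (block_len (Suc (2 * k)) h) (h mod Q) + E (h mod Q)"
      unfolding V_def E_def f_def g_def Q_def L_def by (intro norm_block_sum_le q) (auto simp: H_def)
    also have "\<dots> \<le> U (h mod Q)" by (auto simp: U_def block_len_def L_def V_def)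
    finally show "cmod (\<Sum>y<block_len (Suc (2 * k)) h. f (h + y) * g (h + y)) \<le> U (h mod Q)" .
  qed
  also have "(\<Sum>h\<in>H. U (h mod Q)) = (\<Sum>x<Q. \<Sum>h | h \<in> H \<and> h mod Q = x. U (h mod Q))"
    using Q0 by (intro sum.group [symmetric] finH) auto
  also have "\<dots> = (\<Sum>x<Q. real (card {h \<in> H. h mod Q = x}) * U x)"
    by (intro sum.cong refl) simp
  also have "\<dots> \<le> (\<Sum>x<Q. 14 * real N / (real Q * real L) * U x)"
    using card_block_starts_le[OF Q0 N[unfolded L_def]] U0
    by (intro sum_mono mult_right_mono) (auto simp: H_def L_def conj_assoc)
  also have "\<dots> = 14 * real N / (real Q * real L) * (\<Sum>x<Q. U x)" by (rule sum_distrib_left [symmetric])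
  also have "\<dots> \<le> 14 * real N / (real Q * real L) * (real Q * real L * (4 * r + real L / real Q))"
    by (intro mult_left_mono sumU) simp
  also have "\<dots> = 14 * real N * (4 * r + real L / real Q)" using Q0 L0 by simp
  finally show ?thesis by simp
qed

lemma joint_sum_power_saving:
  fixes q :: nat and \<theta> \<gamma> :: real
  assumes q: "q \<ge> 2" and \<gamma>: "real m * \<gamma> \<notin> \<int>"
  shows "\<exists>\<delta>>0. \<forall>N\<ge>1. cmod (\<Sum>n<N. expi (\<theta> * real (digit_sum q n) + \<gamma> * real (ostrowski_sum a n))) \<le>
    2 * real N powr (1 - \<delta>)"
proof -
  obtain \<rho> where \<rho>: "1 / 2 \<le> \<rho>" "\<rho> < 1" and
    decay: "\<And>\<beta> j. (1 - a) ^ (3 * j) * exp_sum_norm \<gamma> \<beta> (3 * j) \<le> \<rho> ^ j"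
    using exp_sum_norm_decay[OF \<gamma>] by metis
  \<comment> \<open>With k = 3 j and Q <= q L^2, counting block starts requires N >= (m + 3) q^2
    L^5. Since L <= 2 (1 - a)^(-3 j), K B^j suffices: 32 is 2^5 and 15 is 3 times 5.\<close>
  define K where "K = real (m + 3) * real q ^ 2 * 32"
  define B where "B = (1 / (1 - a)) ^ 15"
  have a1: "0 < 1 - a" "1 - a < 1" "1 - a \<le> 1 / 2" using a_pos a_less_1 a_ge_half by simp_all
  show ?thesis
  proof (rule power_saving_of_geometric_saving)
    \<comment> \<open>71 = 1 + 14 (4 + 1): the incomplete block, the exponential sums and the
      carries, in units of N \<rho>^j.\<close>
    show "(71::real) > 0" by simp
    show "B > 1" unfolding B_def using a1 by (intro one_less_power) (auto simp: field_simps)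
    have "1 \<le> real q ^ 2" using q by (intro one_le_power) auto
    then have "1 * 1 * 1 \<le> real (m + 3) * real q ^ 2 * 32" by (intro mult_mono) auto
    then show "K \<ge> 1" by (simp add: K_def)
    show "0 < \<rho>" "\<rho> < 1" using \<rho> by auto
    show "cmod (\<Sum>n<N. expi (\<theta> * real (digit_sum q n) + \<gamma> * real (ostrowski_sum a n))) \<le> real N" for N
      by (rule order_trans[OF sum_norm_le[where g = "\<lambda>_. 1"]]) auto
    fix j N assume N: "K * B ^ j \<le> real N"
    define L where "L = den (Suc (2 * (3 * j)))"
    define \<mu> where "\<mu> = (1 / (1 - a)) ^ (3 * j)"
    have \<mu>: "\<mu> * (1 - a) ^ (3 * j) = 1" "\<mu> > 0" using a1 by (simp_all add: \<mu>_def power_one_over)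
    have L0: "L > 0" by (simp add: L_def)
    have "1 / a \<le> 2" using a_ge_half a_pos by (simp add: field_simps)
    then have "1 \<le> (1 - a) ^ (3 * j) * real L" "(1 - a) ^ (3 * j) * real L \<le> 2"
      using den_bounds[of "3 * j"] unfolding L_def by linarith+
    then have "\<mu> * 1 \<le> \<mu> * ((1 - a) ^ (3 * j) * real L)" "\<mu> * ((1 - a) ^ (3 * j) * real L) \<le> \<mu> * 2"
      using \<mu>(2) by (simp_all only: mult_le_cancel_left_pos)
    then have L: "\<mu> \<le> real L" "real L \<le> 2 * \<mu>" using \<mu>(1) by (simp_all only: mult.assoc [symmetric])
    obtain \<kappa> where \<kappa>: "L ^ 2 \<le> q ^ \<kappa>" "q ^ \<kappa> \<le> q * L ^ 2"
      using ex_power_bracket[OF q, of "L ^ 2"] L0 by auto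
    define Q where "Q = q ^ \<kappa>"
    have QN: "Q * ((m + 3) * Q * L) \<le> N"
    proof -
      have "Q * ((m + 3) * Q * L) \<le> (q * L ^ 2) * ((m + 3) * (q * L ^ 2) * L)"
        using \<kappa>(2) by (intro mult_mono) (auto simp: Q_def)
      also have "\<dots> = (m + 3) * q ^ 2 * L ^ 5" by (simp add: eval_nat_numeral algebra_simps)
      finally have "real (Q * ((m + 3) * Q * L)) \<le> real ((m + 3) * q ^ 2 * L ^ 5)"
        by (simp only: of_nat_le_iff)
      also have "\<dots> = real (m + 3) * real q ^ 2 * real L ^ 5" by simp
      also have "\<dots> \<le> real (m + 3) * real q ^ 2 * (2 * \<mu>) ^ 5"
        using L by (intro mult_left_mono power_mono) auto
      also have "\<dots> = K * B ^ j"
        by (simp add: K_def B_def \<mu>_def power_mult_distrib power_mult [symmetric] mult_ac)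
      finally show ?thesis using N by linarith
    qed
    have L2Q: "real L * real L \<le> real Q"
      using \<kappa>(1) unfolding Q_def power2_eq_square by (simp flip: of_nat_mult of_nat_power)
    have Q0: "Q > 0" using q by (simp add: Q_def)
    have inv: "1 / real L \<le> \<rho> ^ j"
    proof -
      have "1 / real L \<le> 1 / \<mu>" using L \<mu>(2) by (intro divide_left_mono) auto
      also have "\<dots> = ((1 - a) ^ 3) ^ j" by (simp add: \<mu>_def power_one_over power_mult)
      \<comment> \<open>Here the lower bound 1 / 2 on \<rho> enters: (1 - a)^3 <= 1 - a <= 1 /
        2.\<close>
      also have "\<dots> \<le> \<rho> ^ j"
      proof (rule power_mono)
        have "(1 - a) ^ 3 \<le> (1 - a) ^ 1" using a1 by (intro power_decreasing) auto
        then show "(1 - a) ^ 3 \<le> \<rho>" using a1 \<rho> by simp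
      qed (use a1 in auto)
      finally show ?thesis .
    qed
    have "real L / real Q \<le> real L / (real L * real L)"
      using L2Q L0 Q0 by (intro divide_left_mono) auto
    also have "\<dots> = 1 / real L" using L0 by simp
    finally have LQ: "real L / real Q \<le> \<rho> ^ j" using inv by linarith
    have "L * L \<le> N"
    proof -
      have "L * L \<le> Q" using L2Q by (simp flip: of_nat_mult)
      also have "\<dots> \<le> Q * ((m + 3) * Q * L)" using Q0 L0 by simp
      finally show ?thesis using QN by linarith
    qed
    then have "real L \<le> real N * (1 / real L)" using L0 by (simp add: field_simps flip: of_nat_mult)
    also have "\<dots> \<le> real N * \<rho> ^ j" using inv by (intro mult_left_mono) auto
    finally have LN: "real L \<le> real N * \<rho> ^ j" .
    have "cmod (\<Sum>n<N. expi (\<theta> * real (digit_sum q n) + \<gamma> * real (ostrowski_sum a n))) \<le>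
        real L + 14 * real N * (4 * \<rho> ^ j + real L / real Q)"
      unfolding L_def Q_def
      by (rule norm_joint_sum_le[OF q QN[unfolded Q_def L_def] decay])
    also have "\<dots> \<le> real N * \<rho> ^ j + 14 * real N * (4 * \<rho> ^ j + \<rho> ^ j)"
      using LN LQ by (intro add_mono mult_left_mono) auto
    also have "\<dots> = 71 * real N * \<rho> ^ j" by simp
    finally show "cmod (\<Sum>n<N. expi (\<theta> * real (digit_sum q n) + \<gamma> * real (ostrowski_sum a n))) \<le>
        71 * real N * \<rho> ^ j" .
  qed
qed

end

theorem theorem1p2:
  fixes q m :: nat
  assumes "q \<ge> 2" and "m \<ge> 2"
  shows "\<exists>C>0. \<forall>\<theta> \<gamma> :: real. dist_nint (real m * \<gamma>) \<noteq> 0 \<longrightarrow>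
    (\<exists>\<delta>>0. \<forall>N::nat. N \<ge> 1 \<longrightarrow>
      cmod (\<Sum>n<N. expi (\<theta> * real (digit_sum q n) + \<gamma> * real (ostrowski_sum (cf_1m m) n)))
        \<le> C * real N powr (1 - \<delta>))"
proof (rule exI[of _ 2], intro conjI allI impI)
  fix \<theta> \<gamma> :: real
  interpret ostrowski_1m m by unfold_locales (rule assms(2))
  assume "dist_nint (real m * \<gamma>) \<noteq> 0"
  then have "real m * \<gamma> \<notin> \<int>" by (auto simp: dist_nint_def)
  then show "\<exists>\<delta>>0. \<forall>N::nat. N \<ge> 1 \<longrightarrow>
      cmod (\<Sum>n<N. expi (\<theta> * real (digit_sum q n) + \<gamma> * real (ostrowski_sum (cf_1m m) n)))
        \<le> 2 * real N powr (1 - \<delta>)"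
    by (intro joint_sum_power_saving assms(1))
qed simp

end
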